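(* Let $G$ be a vigorous subgroup of $\operatorname{Homeo}(\mathfrak{C})$. The following are equivalent: (1) $G$ is simple; (2) $G$ is flawless; (3) $G=w(G)_\circ$ for $w=x_1^{-1}x_2^{-1}x_1x_2$; (4) $G$ is perfect and generated by its elements of small support; (5) $G$ is perfect and approximately full; (6) $G$ is the commutator subgroup of its own full group within $\operatorname{Homeo}(\mathfrak{C})$.
   Context: $\mathfrak{C}$ denotes a Cantor space (a space homeomorphic to $\{0,1\}^\omega$). Groups of homeomorphisms act on the right, and products are composed left to right. $K_{\mathfrak{C}}$ denotes the set of non-empty proper clopen subsets of $\mathfrak{C}$. For $\gamma\in\operatorname{Homeo}(\mathfrak{C})$, $\operatorname{supp}(\gamma)=\{p\in\mathfrak{C}: p\gamma\neq p\}$. For $G\le\operatorname{Homeo}(\mathfrak{C})$ and $A\subseteq\mathfrak{C}$, $\operatorname{pstab}_G(A)=\{g\in G: pg=p \text{ for all } p\in A\}$. A subset $S\subseteq \operatorname{Homeo}(\mathfrak{C})$ is vigorous if for all clopen $A,B,C\subseteq\mathfrak{C}$ with $B,C$ non-empty proper subsets of $A$ there is $\gamma\in S$ with $\operatorname{supp}(\gamma)\subseteq A$ and $B\gamma\subseteq C$. For a word $w$ in letters $x_1^{\pm1},\dots,x_j^{\pm1}$ and a group $H$, $w[H]$ is the image of the evaluation map $H^j\to H$ substituting $h_i$ for $x_i$. For $G\le\operatorname{Homeo}(\mathfrak{C})$ set $w[G]_\circ=\bigcup_{A\in K_{\mathfrak{C}}} w[\operatorname{pstab}_G(A)]$ and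 $w(G)_\circ=\langle w[G]_\circ\rangle$. $G$ is flawless if $G=w(G)_\circ$ for every non-trivial freely reduced word $w$. $G$ is generated by its elements of small support if $G$ is generated by $\{\gamma\in G: \operatorname{supp}(\gamma)\subseteq A \text{ for some } A\in K_{\mathfrak{C}}\}$ (equivalently $G=x(G)_\circ$). $G$ is approximately full if whenever $\Gamma\subseteq G$ is finite, $\{D_\gamma\}_{\gamma\in\Gamma}$ is a partition of $\mathfrak{C}$ into clopen sets such that $\{D_\gamma\gamma\}_{\gamma\in\Gamma}$ is also a partition of $\mathfrak{C}$, and $\delta\in\Gamma$, there exists $\chi\in G$ with $\chi|_{D_\gamma}=\gamma|_{D_\gamma}$ for every $\gamma\in\Gamma\setminus\{\delta\}$. The full group of $G$ is the set of $h\in\operatorname{Homeo}(\mathfrak{C})$ for which there exist a finite partition $\{D_1,\dots,D_k\}$ of $\mathfrak{C}$ into clopen sets and $g_1,\dots,g_k\in G$ with $h|_{D_i}=g_i|_{D_i}$ for each $i$. *)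

theory Defs
  imports "HOL-Analysis.Analysis" "HOL-Algebra.Algebra"
begin

type_synonym cantor = "nat \<Rightarrow> bool"

definition cantor_top :: "cantor topology" where
  "cantor_top = product_topology (\<lambda>_::nat. discrete_topology (UNIV::bool set)) UNIV"

definition clopen_set :: "cantor set \<Rightarrow> bool" where
  "clopen_set A \<longleftrightarrow> openin cantor_top A \<and> closedin cantor_top A"

definition K_C :: "cantor set set" where
  "K_C = {A. clopen_set A \<and> A \<noteq> {} \<and> A \<noteq> UNIV}"

text \<open>Homeo(C), acting on the right, products composed left to right:
  \<open>p (g h) = (p g) h\<close>, i.e. the product \<open>g \<otimes> h\<close> is the function \<open>h \<circ> g\<close>.\<close>
definition homeo_group :: "(cantor \<Rightarrow> cantor) monoid" where
  "homeo_group = \<lparr> carrier = {f. homeomorphic_map cantor_top cantor_top f},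
                   mult = (\<lambda>g h. h \<circ> g), one = id \<rparr>"

definition gp :: "(cantor \<Rightarrow> cantor) set \<Rightarrow> (cantor \<Rightarrow> cantor) monoid" where
  "gp G = homeo_group\<lparr>carrier := G\<rparr>"

definition supp :: "(cantor \<Rightarrow> cantor) \<Rightarrow> cantor set" where
  "supp g = {p. g p \<noteq> p}"

definition pstab :: "(cantor \<Rightarrow> cantor) set \<Rightarrow> cantor set \<Rightarrow> (cantor \<Rightarrow> cantor) set" where
  "pstab G A = {g \<in> G. \<forall>p\<in>A. g p = p}"

definition vigorous :: "(cantor \<Rightarrow> cantor) set \<Rightarrow> bool" where
  "vigorous S \<longleftrightarrow>
     (\<forall>A B C. clopen_set A \<and> clopen_set B \<and> clopen_set C \<and>
        B \<noteq> {} \<and> B \<subset> A \<and> C \<noteq> {} \<and> C \<subset> A \<longrightarrow>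
        (\<exists>\<gamma>\<in>S. supp \<gamma> \<subseteq> A \<and> \<gamma> ` B \<subseteq> C))"

text \<open>A word in letters \<open>x_i^{\<pm>1}\<close>: list of pairs \<open>(i, e)\<close>, where \<open>e = True\<close> means
  the letter \<open>x_i^{-1}\<close> and \<open>e = False\<close> means \<open>x_i\<close>.\<close>
type_synonym word = "(nat \<times> bool) list"

definition freely_reduced :: "word \<Rightarrow> bool" where
  "freely_reduced w \<longleftrightarrow> successively (\<lambda>a b. \<not> (fst a = fst b \<and> snd a \<noteq> snd b)) w"

definition eval_word :: "('a, 'b) monoid_scheme \<Rightarrow> word \<Rightarrow> (nat \<Rightarrow> 'a) \<Rightarrow> 'a" where
  "eval_word M w h =
     foldr (\<lambda>(i, e) acc. (if e then inv\<^bsub>M\<^esub> (h i) else h i) \<otimes>\<^bsub>M\<^esub> acc) w \<one>\<^bsub>M\<^esub>"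

definition word_image :: "('a, 'b) monoid_scheme \<Rightarrow> word \<Rightarrow> 'a set \<Rightarrow> 'a set" where
  "word_image M w H = {eval_word M w h | h. \<forall>i. h i \<in> H}"

definition word_set_circ :: "word \<Rightarrow> (cantor \<Rightarrow> cantor) set \<Rightarrow> (cantor \<Rightarrow> cantor) set" where
  "word_set_circ w G = (\<Union>A\<in>K_C. word_image (gp G) w (pstab G A))"

definition word_subgroup_circ :: "word \<Rightarrow> (cantor \<Rightarrow> cantor) set \<Rightarrow> (cantor \<Rightarrow> cantor) set" where
  "word_subgroup_circ w G = generate (gp G) (word_set_circ w G)"

definition flawless :: "(cantor \<Rightarrow> cantor) set \<Rightarrow> bool" where
  "flawless G \<longleftrightarrow> (\<forall>w. w \<noteq> [] \<and> freely_reduced w \<longrightarrow> G = word_subgroup_circ w G)"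

definition comm_word :: word where
  "comm_word = [(1, True), (2, True), (1, False), (2, False)]"

definition simple_grp :: "('a, 'b) monoid_scheme \<Rightarrow> bool" where
  "simple_grp M \<longleftrightarrow> group M \<and> carrier M \<noteq> {\<one>\<^bsub>M\<^esub>} \<and>
     (\<forall>N. N \<lhd> M \<longrightarrow> N = {\<one>\<^bsub>M\<^esub>} \<or> N = carrier M)"

definition perfect :: "(cantor \<Rightarrow> cantor) set \<Rightarrow> bool" where
  "perfect G \<longleftrightarrow> derived (gp G) G = G"

definition gen_small_support :: "(cantor \<Rightarrow> cantor) set \<Rightarrow> bool" where
  "gen_small_support G \<longleftrightarrow>
     G = generate (gp G) {\<gamma> \<in> G. \<exists>A\<in>K_C. supp \<gamma> \<subseteq> A}"

definition approx_full :: "(cantor \<Rightarrow> cantor) set \<Rightarrow> bool" where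
  "approx_full G \<longleftrightarrow>
     (\<forall>\<Gamma> D \<delta>. finite \<Gamma> \<and> \<Gamma> \<subseteq> G \<and> \<delta> \<in> \<Gamma> \<and>
        (\<forall>\<gamma>\<in>\<Gamma>. clopen_set (D \<gamma>) \<and> D \<gamma> \<noteq> {}) \<and>
        (\<forall>\<gamma>\<in>\<Gamma>. \<forall>\<gamma>'\<in>\<Gamma>. \<gamma> \<noteq> \<gamma>' \<longrightarrow> D \<gamma> \<inter> D \<gamma>' = {}) \<and>
        (\<Union>\<gamma>\<in>\<Gamma>. D \<gamma>) = UNIV \<and>
        (\<forall>\<gamma>\<in>\<Gamma>. clopen_set (\<gamma> ` D \<gamma>)) \<and>
        (\<forall>\<gamma>\<in>\<Gamma>. \<forall>\<gamma>'\<in>\<Gamma>. \<gamma> \<noteq> \<gamma>' \<longrightarrow> \<gamma> ` D \<gamma> \<inter> \<gamma>' ` D \<gamma>' = {}) \<and>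
        (\<Union>\<gamma>\<in>\<Gamma>. \<gamma> ` D \<gamma>) = UNIV
      \<longrightarrow> (\<exists>k\<in>G. \<forall>\<gamma>\<in>\<Gamma> - {\<delta>}. \<forall>p\<in>D \<gamma>. k p = \<gamma> p))"

definition full_group :: "(cantor \<Rightarrow> cantor) set \<Rightarrow> (cantor \<Rightarrow> cantor) set" where
  "full_group G =
     {h \<in> carrier homeo_group. \<exists>P. finite P \<and> (\<forall>D\<in>P. clopen_set D) \<and>
        (\<forall>D\<in>P. \<forall>D'\<in>P. D \<noteq> D' \<longrightarrow> D \<inter> D' = {}) \<and> \<Union>P = UNIV \<and>
        (\<forall>D\<in>P. \<exists>g\<in>G. \<forall>p\<in>D. h p = g p)}"

end

theory Submission
  imports Defs
begin

text \<open>
  The commutator trick: if a nontrivial \<open>n\<close> in a subgroup \<open>N\<close> normalised by \<open>G\<close> moves \<open>U\<close>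
  off itself, then \<open>N\<close> contains all commutators of elements supported in \<open>U\<close>. By vigour \<open>U\<close>
  may be any small set, so \<open>N\<close> contains the derived subgroup as soon as \<open>G\<close> is generated by
  elements of small support. This gives simplicity of perfect \<open>G\<close>; as vigorous groups satisfy
  no laws, the verbal subgroups are nontrivial and simplicity gives flawlessness.

  If \<open>G\<close> is generated by elements of small support, then germs of elements of \<open>G\<close> are realised
  with arbitrarily small support, and elements with disjoint supports can be glued: every element
  of the full group agrees, off any nonempty clopen set, with an element of \<open>G\<close>. Hence \<open>G\<close> is
  approximately full and normal in its full group, which is itself vigorous and generated by
  elements of small support, so the commutator trick applies there too.
\<close>

section \<open>Clopen sets and homeomorphisms of the Cantor space\<close>

text \<open>The full group may be larger than \<open>G\<close>, so an element of \<open>G\<close>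
  cannot be prescribed on the whole space: cutting and pasting inside \<open>G\<close> must leave
  some nonempty clopen set free. Hence the strict inclusions such as \<open>U \<subset> E\<close>;
  the spare part of \<open>E\<close> is where vigour hides unwanted support. A second obstacle is
  that a product of elements of small support may move every point. Near one point, however, only
  its successive images matter, and these always fit into a proper clopen set. In the full group
  gluing is unrestricted, so generation by elements of small support is automatic there, whereas for
  \<open>G\<close> it is one of the conditions at stake.\<close>

lemma topspace_cantor [simp]: "topspace cantor_top = UNIV"
  by (simp add: cantor_top_def PiE_UNIV_domain)

lemma compact_space_cantor: "compact_space cantor_top"
  by (auto simp: cantor_top_def compact_space_product_topology compact_space_discrete_topology)

lemma Hausdorff_space_cantor: "Hausdorff_space cantor_top"
  by (auto simp: cantor_top_def Hausdorff_space_product_topology)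

lemma clopen_empty [simp]: "clopen_set {}"
  by (simp add: clopen_set_def)

lemma clopen_UNIV [simp]: "clopen_set UNIV"
  using openin_topspace[of cantor_top] closedin_topspace[of cantor_top]
  by (simp add: clopen_set_def)

lemma clopen_Un: "clopen_set A \<Longrightarrow> clopen_set B \<Longrightarrow> clopen_set (A \<union> B)"
  by (auto simp: clopen_set_def)

lemma clopen_Int: "clopen_set A \<Longrightarrow> clopen_set B \<Longrightarrow> clopen_set (A \<inter> B)"
  by (auto simp: clopen_set_def)

lemma clopen_Diff: "clopen_set A \<Longrightarrow> clopen_set B \<Longrightarrow> clopen_set (A - B)"
  by (auto simp: clopen_set_def)

lemma clopen_Compl: "clopen_set A \<Longrightarrow> clopen_set (- A)"
  using clopen_Diff[of UNIV A] by (simp add: Compl_eq_Diff_UNIV)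

lemmas clopen_intros = clopen_Un clopen_Int clopen_Diff clopen_Compl

lemma clopen_vimage:
  assumes "continuous_map cantor_top cantor_top f" "clopen_set A"
  shows "clopen_set (f -` A)"
  using openin_continuous_map_preimage[OF assms(1), of A]
    closedin_continuous_map_preimage[OF assms(1), of A] assms(2)
  by (auto simp: clopen_set_def vimage_def)

lemma clopen_cylinder: "clopen_set {x. x (n::nat) = b}"
proof -
  have c: "continuous_map cantor_top (discrete_topology UNIV) (\<lambda>x. x n)"
    unfolding cantor_top_def by (rule continuous_map_product_projection) simp
  show ?thesis
    using openin_continuous_map_preimage[OF c, of "{b}"] closedin_continuous_map_preimage[OF c, of "{b}"]
    by (auto simp: clopen_set_def)
qed

lemma clopen_separates:
  assumes "finite F" "p \<notin> F"
  shows "\<exists>U. clopen_set U \<and> p \<in> U \<and> U \<inter> F = {}"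
  using assms
proof (induction F)
  case empty
  then show ?case using clopen_UNIV by blast
next
  case (insert q F)
  then obtain U where U: "clopen_set U" "p \<in> U" "U \<inter> F = {}" by auto
  from insert obtain n where n: "p n \<noteq> q n" by auto
  have "clopen_set (U \<inter> {x. x n = p n})" using U clopen_cylinder by (intro clopen_intros) auto
  moreover have "p \<in> U \<inter> {x. x n = p n}" "(U \<inter> {x. x n = p n}) \<inter> insert q F = {}"
    using U n by auto
  ultimately show ?case by blast
qed

text \<open>A basic open box around \<open>p\<close> constrains only finitely many coordinates;
  flipping any single one of the others stays in \<open>A\<close>, and distinct coordinates give
  distinct points.\<close>

lemma clopen_infinite:
  assumes "clopen_set A" "A \<noteq> {}"
  shows "infinite A"
proof
  assume fin: "finite A"
  obtain p where p: "p \<in> A" using assms by auto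
  have "openin (product_topology (\<lambda>_::nat. discrete_topology (UNIV::bool set)) UNIV) A"
    using assms by (simp add: clopen_set_def cantor_top_def)
  then obtain U where U: "finite {i::nat. U i \<noteq> (UNIV::bool set)}" "p \<in> Pi\<^sub>E UNIV U" "Pi\<^sub>E UNIV U \<subseteq> A"
    using p unfolding openin_product_topology_alt by fastforce
  define J where "J = {i. U i = UNIV}"
  have inf: "infinite J"
    using U(1) unfolding J_def
    by (metis (mono_tags) Collect_neg_eq finite_Collect_not infinite_UNIV_nat)
  have "inj_on (\<lambda>i. p(i := \<not> p i)) J"
    by (rule inj_onI) (metis fun_upd_apply)
  moreover have "(\<lambda>i. p(i := \<not> p i)) ` J \<subseteq> A"
    using U(2,3) by (fastforce simp: J_def PiE_UNIV_domain)
  ultimately show False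
    using inf fin by (meson finite_imageD finite_subset)
qed

text \<open>Excluding one further point \<open>p\<close> of \<open>A\<close> together with
  \<open>F\<close> makes the inclusion strict. This is the source of all spare room reserved
  later.\<close>

lemma clopen_proper_part:
  assumes "clopen_set A" "A \<noteq> {}" "finite F"
  shows "\<exists>U. clopen_set U \<and> U \<noteq> {} \<and> U \<subset> A \<and> U \<inter> F = {}"
proof -
  obtain p where p: "p \<in> A" using assms by auto
  have "\<not> A \<subseteq> insert p F"
    using clopen_infinite[OF assms(1,2)] assms(3) by (meson finite.insertI finite_subset)
  then obtain q where q: "q \<in> A" "q \<notin> insert p F" by auto
  obtain U where U: "clopen_set U" "q \<in> U" "U \<inter> insert p F = {}"
    using clopen_separates[of "insert p F" q] q assms(3) by blast
  show ?thesis
  proof (intro exI[of _ "U \<inter> A"] conjI)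
    show "clopen_set (U \<inter> A)" using U assms by (intro clopen_Int)
  qed (use U p q in auto)
qed

text \<open>Compactness as an induction principle. Additivity is demanded for disjoint unions only,
  because partial homeomorphisms can be glued along disjoint pieces.\<close>

lemma clopen_local_induct:
  assumes U: "clopen_set U"
    and loc: "\<And>p. p \<in> U \<Longrightarrow> \<exists>V. clopen_set V \<and> p \<in> V \<and> R V"
    and sub: "\<And>V W. clopen_set V \<Longrightarrow> clopen_set W \<Longrightarrow> V \<subseteq> W \<Longrightarrow> R W \<Longrightarrow> R V"
    and un: "\<And>V W. clopen_set V \<Longrightarrow> clopen_set W \<Longrightarrow> V \<inter> W = {} \<Longrightarrow> R V \<Longrightarrow> R W \<Longrightarrow> R (V \<union> W)"
    and emp: "R {}"
  shows "R U"
proof -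
  have "compactin cantor_top U"
    using U compact_space_cantor closedin_compact_space unfolding clopen_set_def by blast
  moreover have "\<And>V. V \<in> {V. clopen_set V \<and> R V} \<Longrightarrow> openin cantor_top V"
    by (auto simp: clopen_set_def)
  moreover have "U \<subseteq> \<Union>{V. clopen_set V \<and> R V}"
    using loc by blast
  ultimately obtain \<F> where \<F>: "finite \<F>" "\<F> \<subseteq> {V. clopen_set V \<and> R V}" "U \<subseteq> \<Union>\<F>"
    by (meson compactinD)
  have "clopen_set (\<Union>\<F>) \<and> R (\<Union>\<F>)"
    using \<F>(1,2)
  proof (induction \<F>)
    case empty
    then show ?case using emp by simp
  next
    case (insert V \<F>)
    then have c: "clopen_set V" "R V" "clopen_set (\<Union>\<F>)" "R (\<Union>\<F>)" by auto
    \<comment> \<open>Removing what is already covered makes the union disjoint, as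
      \<open>un\<close> demands.\<close>
    have "R (V - \<Union>\<F>)" using sub[of "V - \<Union>\<F>" V] c by (auto intro: clopen_intros)
    then have "R ((V - \<Union>\<F>) \<union> \<Union>\<F>)"
      using c by (intro un) (auto intro: clopen_intros)
    moreover have "(V - \<Union>\<F>) \<union> \<Union>\<F> = \<Union>(insert V \<F>)" by auto
    ultimately have "R (\<Union>(insert V \<F>))" by metis
    moreover have "clopen_set (\<Union>(insert V \<F>))" using c by (auto intro: clopen_intros)
    ultimately show ?case by blast
  qed
  then show ?thesis using sub[OF U _ \<F>(3)] by blast
qed

section \<open>Homeomorphisms, their inverses and displaced clopen sets\<close>

abbreviation iv :: "(cantor \<Rightarrow> cantor) \<Rightarrow> cantor \<Rightarrow> cantor" where
  "iv \<equiv> inv_into UNIV"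

text \<open>A continuous bijection from a compact space to a Hausdorff space has a continuous
  inverse, so inverses never need a separate continuity check.\<close>

lemma homeo_iff:
  "f \<in> carrier homeo_group \<longleftrightarrow> continuous_map cantor_top cantor_top f \<and> bij f"
proof
  assume "f \<in> carrier homeo_group"
  then have "homeomorphic_map cantor_top cantor_top f" by (simp add: homeo_group_def)
  then show "continuous_map cantor_top cantor_top f \<and> bij f"
    using homeomorphic_imp_injective_map homeomorphic_imp_surjective_map homeomorphic_imp_continuous_map
    by (fastforce simp: bij_def)
next
  assume "continuous_map cantor_top cantor_top f \<and> bij f"
  then have "homeomorphic_map cantor_top cantor_top f"
    by (intro continuous_imp_homeomorphic_map[OF _ compact_space_cantor Hausdorff_space_cantor])
      (auto simp: bij_def)
  then show "f \<in> carrier homeo_group" by (simp add: homeo_group_def)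
qed

lemma homeo_bij: "f \<in> carrier homeo_group \<Longrightarrow> bij f"
  by (simp add: homeo_iff)

lemma iv_cancel [simp]:
  assumes "f \<in> carrier homeo_group"
  shows "iv f (f x) = x" "f (iv f x) = x"
  using homeo_bij[OF assms] by (simp_all add: bij_is_inj bij_is_surj surj_f_inv_f)

lemma homeo_eq_iff: "f \<in> carrier homeo_group \<Longrightarrow> f x = f y \<longleftrightarrow> x = y"
  by (meson homeo_bij bij_is_inj inj_eq)

lemma homeo_id: "id \<in> carrier homeo_group"
  by (simp add: homeo_iff)

lemma homeo_comp: "f \<in> carrier homeo_group \<Longrightarrow> g \<in> carrier homeo_group \<Longrightarrow> f \<circ> g \<in> carrier homeo_group"
  by (auto simp: homeo_iff bij_comp intro: continuous_map_compose)

lemma homeo_iv: "f \<in> carrier homeo_group \<Longrightarrow> iv f \<in> carrier homeo_group"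
proof -
  assume f: "f \<in> carrier homeo_group"
  then have "homeomorphic_map cantor_top cantor_top f" by (simp add: homeo_group_def)
  then obtain g where g: "homeomorphic_maps cantor_top cantor_top f g"
    using homeomorphic_map_maps by blast
  then have "iv f = g"
    using f by (intro ext) (metis UNIV_I homeomorphic_maps_def iv_cancel(1) topspace_cantor)
  with g have "homeomorphic_map cantor_top cantor_top (iv f)"
    by (simp add: homeomorphic_maps_map)
  then show ?thesis by (simp add: homeo_group_def)
qed

lemma clopen_homeo_vimage: "f \<in> carrier homeo_group \<Longrightarrow> clopen_set A \<Longrightarrow> clopen_set (f -` A)"
  by (simp add: homeo_iff clopen_vimage)

lemma clopen_homeo_image: "f \<in> carrier homeo_group \<Longrightarrow> clopen_set A \<Longrightarrow> clopen_set (f ` A)"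
  using clopen_homeo_vimage[OF homeo_iv, of f A] homeo_bij[of f]
  by (metis bij_imp_bij_inv bij_vimage_eq_inv_image inv_inv_eq)

lemma homeo_locally:
  assumes bij: "bij f"
    and loc: "\<And>p. \<exists>U g. clopen_set U \<and> p \<in> U \<and> g \<in> carrier homeo_group \<and> (\<forall>x\<in>U. f x = g x)"
  shows "f \<in> carrier homeo_group"
proof -
  have "openin cantor_top (f -` W)" if W: "openin cantor_top W" for W
  proof (subst openin_subopen, intro ballI)
    fix p assume p: "p \<in> f -` W"
    obtain U g where U: "clopen_set U" "p \<in> U" "g \<in> carrier homeo_group" "\<forall>x\<in>U. f x = g x"
      using loc by blast
    have "openin cantor_top (g -` W)"
      using openin_continuous_map_preimage[of cantor_top cantor_top g W] U(3) W
      by (auto simp: homeo_iff vimage_def)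
    then have "openin cantor_top (U \<inter> g -` W)" using U(1) by (auto simp: clopen_set_def)
    moreover have "p \<in> U \<inter> g -` W" "U \<inter> g -` W \<subseteq> f -` W" using U p by auto
    ultimately show "\<exists>T. openin cantor_top T \<and> p \<in> T \<and> T \<subseteq> f -` W" by blast
  qed
  then have "continuous_map cantor_top cantor_top f"
    by (simp add: continuous_map_def vimage_def)
  with bij show ?thesis by (simp add: homeo_iff)
qed

lemma displaced_clopen:
  assumes f: "f \<in> carrier homeo_group" and p: "f p \<noteq> p"
  obtains U where "clopen_set U" "p \<in> U" "U \<inter> f ` U = {}" "U \<union> f ` U \<noteq> UNIV"
proof -
  obtain q where q: "q \<notin> {p, f p}"
    using ex_new_if_finite[OF clopen_infinite[OF clopen_UNIV UNIV_not_empty], of "{p, f p}"] by auto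
  obtain V where V: "clopen_set V" "p \<in> V" "V \<inter> {f p, q} = {}"
    using clopen_separates[of "{f p, q}" p] p q by auto
  obtain W where W: "clopen_set W" "f p \<in> W" "W \<inter> {p, q} = {}"
    using clopen_separates[of "{p, q}" "f p"] p q by auto
  \<comment> \<open>\<open>V - W\<close> and \<open>W - V\<close> are disjoint and both miss
    \<open>q\<close>. As \<open>U\<close> lies in the first and its image in the second, they are
    disjoint and do not cover the space.\<close>
  define U where "U = (V - W) \<inter> f -` (W - V)"
  show ?thesis
  proof (rule that[of U])
    show "clopen_set U" unfolding U_def using V W f by (intro clopen_intros clopen_homeo_vimage)
    show "p \<in> U" using V W by (auto simp: U_def)
    show "U \<inter> f ` U = {}" by (auto simp: U_def)
    show "U \<union> f ` U \<noteq> UNIV" using V W by (auto simp: U_def)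
  qed
qed

section \<open>Subgroups, conjugation and rigid stabilizers\<close>

lemma group_homeo: "group homeo_group"
proof (rule groupI)
  fix f assume "f \<in> carrier homeo_group"
  then show "\<exists>y\<in>carrier homeo_group. y \<otimes>\<^bsub>homeo_group\<^esub> f = \<one>\<^bsub>homeo_group\<^esub>"
    by (intro bexI[of _ "iv f"]) (auto simp: homeo_iv homeo_group_def[THEN arg_cong, of mult]
        homeo_group_def[THEN arg_cong, of one])
qed (use homeo_comp homeo_id in \<open>auto simp: homeo_group_def comp_assoc\<close>)

lemma homeo_mult [simp]: "f \<otimes>\<^bsub>homeo_group\<^esub> g = g \<circ> f"
  and homeo_one [simp]: "\<one>\<^bsub>homeo_group\<^esub> = id"
  by (simp_all add: homeo_group_def)

lemma gp_simps [simp]: "carrier (gp G) = G" "f \<otimes>\<^bsub>gp G\<^esub> g = g \<circ> f" "\<one>\<^bsub>gp G\<^esub> = id"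
  by (simp_all add: gp_def)

lemma homeo_m_inv: "f \<in> carrier homeo_group \<Longrightarrow> m_inv homeo_group f = iv f"
  by (rule group.inv_equality[OF group_homeo]) (auto simp: homeo_iv fun_eq_iff)

lemma iv_comp: "f \<in> carrier homeo_group \<Longrightarrow> g \<in> carrier homeo_group \<Longrightarrow> iv (f \<circ> g) = iv g \<circ> iv f"
  by (simp add: o_inv_distrib homeo_bij)

lemma iv_iv: "f \<in> carrier homeo_group \<Longrightarrow> iv (iv f) = f"
  by (simp add: inv_inv_eq homeo_bij)

lemma iv_eqI: "f \<in> carrier homeo_group \<Longrightarrow> f x = y \<Longrightarrow> iv f y = x"
  by auto

lemma supp_subset_iff: "supp g \<subseteq> A \<longleftrightarrow> (\<forall>x. x \<notin> A \<longrightarrow> g x = x)"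
  by (auto simp: supp_def)

text \<open>Written with function composition; in the left-to-right product this is the inverse of
  \<open>k\<close>, then \<open>g\<close>, then \<open>k\<close>. With this choice supports are
  transported forward by \<open>k\<close>.\<close>

definition conj_by :: "(cantor \<Rightarrow> cantor) \<Rightarrow> (cantor \<Rightarrow> cantor) \<Rightarrow> cantor \<Rightarrow> cantor" where
  "conj_by k g = k \<circ> g \<circ> iv k"

definition commutator :: "(cantor \<Rightarrow> cantor) \<Rightarrow> (cantor \<Rightarrow> cantor) \<Rightarrow> cantor \<Rightarrow> cantor" where
  "commutator g h = g \<circ> h \<circ> iv g \<circ> iv h"

text \<open>The rigid stabilizer, that is \<open>pstab\<close> of the complement. Supports behave
  well under conjugation and gluing, hence the change of viewpoint.\<close>

definition rist :: "(cantor \<Rightarrow> cantor) set \<Rightarrow> cantor set \<Rightarrow> (cantor \<Rightarrow> cantor) set" where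
  "rist G A = {g \<in> G. supp g \<subseteq> A}"

definition small_elements :: "(cantor \<Rightarrow> cantor) set \<Rightarrow> (cantor \<Rightarrow> cantor) set" where
  "small_elements G = {g \<in> G. \<exists>A\<in>K_C. supp g \<subseteq> A}"

lemma conj_by_comp:
  "k \<in> carrier homeo_group \<Longrightarrow> conj_by k (f \<circ> g) = conj_by k f \<circ> conj_by k g"
  by (simp add: conj_by_def fun_eq_iff)

lemma conj_by_iv:
  assumes "k \<in> carrier homeo_group" "g \<in> carrier homeo_group"
  shows "conj_by k (iv g) = iv (conj_by k g)"
  using assms by (simp add: conj_by_def iv_comp homeo_comp homeo_iv iv_iv comp_assoc)

lemma conj_by_id: "k \<in> carrier homeo_group \<Longrightarrow> conj_by k id = id"
  by (simp add: conj_by_def fun_eq_iff)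

lemma conj_by_commutator:
  assumes "k \<in> carrier homeo_group" "g \<in> carrier homeo_group" "h \<in> carrier homeo_group"
  shows "conj_by k (commutator g h) = commutator (conj_by k g) (conj_by k h)"
  using assms by (simp add: commutator_def conj_by_comp conj_by_iv)

lemma rist_outside: "g \<in> rist G A \<Longrightarrow> x \<notin> A \<Longrightarrow> g x = x"
  by (auto simp: rist_def supp_def)

lemma rist_mono: "A \<subseteq> B \<Longrightarrow> rist G A \<subseteq> rist G B"
  by (auto simp: rist_def)

lemma rist_subset: "rist G A \<subseteq> G"
  by (auto simp: rist_def)

lemma rist_in: "g \<in> rist G A \<Longrightarrow> g \<in> G"
  by (simp add: rist_def)

lemma pstab_eq_rist: "pstab G A = rist G (- A)"
  by (auto simp: pstab_def rist_def supp_def)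

lemma small_elements_iff: "g \<in> small_elements G \<longleftrightarrow> (\<exists>A\<in>K_C. g \<in> rist G A)"
  by (auto simp: small_elements_def rist_def)

lemma small_elements_eq_pstab: "small_elements G = (\<Union>A\<in>K_C. pstab G A)"
proof -
  have "A \<in> K_C \<longleftrightarrow> - A \<in> K_C" for A
    using clopen_Compl[of A] clopen_Compl[of "- A"] by (auto simp: K_C_def)
  then show ?thesis
    unfolding set_eq_iff UN_iff small_elements_iff pstab_eq_rist by (metis double_compl)
qed

locale homeo_subgroup =
  fixes G :: "(cantor \<Rightarrow> cantor) set"
  assumes subgroup: "subgroup G homeo_group"
begin

lemma homeo [simp, intro]: "g \<in> G \<Longrightarrow> g \<in> carrier homeo_group"
  using subgroup.subset[OF subgroup] by blast

lemma id_closed [simp]: "id \<in> G"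
  using subgroup.one_closed[OF subgroup] by simp

lemma comp_closed: "g \<in> G \<Longrightarrow> h \<in> G \<Longrightarrow> g \<circ> h \<in> G"
  using subgroup.m_closed[OF subgroup, of h g] by simp

lemma iv_closed: "g \<in> G \<Longrightarrow> iv g \<in> G"
  using subgroup.m_inv_closed[OF subgroup, of g] by (simp add: homeo_m_inv)

lemma conj_closed: "k \<in> G \<Longrightarrow> g \<in> G \<Longrightarrow> conj_by k g \<in> G"
  by (simp add: conj_by_def comp_closed iv_closed)

lemma commutator_closed: "g \<in> G \<Longrightarrow> h \<in> G \<Longrightarrow> commutator g h \<in> G"
  by (simp add: commutator_def comp_closed iv_closed)

lemma group_gp: "group (gp G)"
  unfolding gp_def by (rule subgroup.subgroup_is_group[OF subgroup group_homeo])

lemma gp_m_inv [simp]: "g \<in> G \<Longrightarrow> m_inv (gp G) g = iv g"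
  unfolding gp_def by (simp add: group.m_inv_consistent[OF group_homeo subgroup] homeo_m_inv)

lemma generate_subset: "S \<subseteq> G \<Longrightarrow> generate (gp G) S \<subseteq> G"
  using group.generate_in_carrier[OF group_gp] by auto

lemma generate_subgroup: "S \<subseteq> G \<Longrightarrow> homeo_subgroup (generate (gp G) S)"
  unfolding homeo_subgroup_def
  using group.incl_subgroup[OF group_homeo subgroup] group.generate_is_subgroup[OF group_gp, of S]
  by (simp add: gp_def)

lemma generate_least:
  assumes "S \<subseteq> G" "S \<subseteq> N" "homeo_subgroup N"
  shows "generate (gp G) S \<subseteq> N"
proof
  interpret N: homeo_subgroup N by fact
  fix g assume "g \<in> generate (gp G) S"
  then show "g \<in> N"
  proof induction
    case one
    show ?case unfolding gp_simps by (rule N.id_closed)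
  next
    case (eng h1 h2)
    then show ?case unfolding gp_simps by (intro N.comp_closed)
  next
    case (inv h)
    then have "h \<in> G" "h \<in> N" using assms by auto
    then show ?case by (metis gp_m_inv N.iv_closed)
  qed (use assms in auto)
qed

text \<open>Here \<open>k\<close> need not belong to \<open>G\<close>; this permits conjugation by
  elements of the full group.\<close>

lemma generate_conj_closed:
  assumes S: "S \<subseteq> G" and k: "k \<in> carrier homeo_group"
    and conj: "\<And>s. s \<in> S \<Longrightarrow> conj_by k s \<in> S" and g: "g \<in> generate (gp G) S"
  shows "conj_by k g \<in> generate (gp G) S"
  using g
proof induction
  case one
  show ?case
    using generate.one[of "gp G" S] unfolding gp_simps conj_by_id[OF k] .
next
  case (incl h)
  then show ?case using conj by (simp add: generate.incl)
next
  case (inv h)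
  have h: "h \<in> G" "conj_by k h \<in> G" using inv S conj by auto
  then have "conj_by k (m_inv (gp G) h) = m_inv (gp G) (conj_by k h)"
    using k by (simp add: conj_by_iv)
  then show ?case using generate.inv[OF conj[OF inv], of "gp G"] by simp
next
  case (eng h1 h2)
  show ?case
    using generate.eng[OF eng.IH] unfolding gp_simps conj_by_comp[OF k] .
qed

text \<open>The library commutator is formed in the left-to-right product, so as a function it is
  \<open>commutator\<close> of the inverses in swapped order. The two sets agree because
  \<open>g\<close> and \<open>h\<close> range over a group.\<close>

lemma derived_eq:
  "derived (gp G) G = generate (gp G) {commutator g h |g h. g \<in> G \<and> h \<in> G}"
proof -
  have "(\<Union>g\<in>G. \<Union>h\<in>G. {g \<otimes>\<^bsub>gp G\<^esub> h \<otimes>\<^bsub>gp G\<^esub> m_inv (gp G) g \<otimes>\<^bsub>gp G\<^esub> m_inv (gp G) h})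
     = {commutator g h |g h. g \<in> G \<and> h \<in> G}" (is "?L = ?R")
  proof -
    have eq: "g \<otimes>\<^bsub>gp G\<^esub> h \<otimes>\<^bsub>gp G\<^esub> m_inv (gp G) g \<otimes>\<^bsub>gp G\<^esub> m_inv (gp G) h = commutator (iv h) (iv g)"
      if "g \<in> G" "h \<in> G" for g h
      using that by (simp add: commutator_def iv_iv comp_assoc)
    have "commutator g h \<in> ?L" if "g \<in> G" "h \<in> G" for g h
    proof -
      have "commutator g h = iv h \<otimes>\<^bsub>gp G\<^esub> iv g \<otimes>\<^bsub>gp G\<^esub> m_inv (gp G) (iv h) \<otimes>\<^bsub>gp G\<^esub> m_inv (gp G) (iv g)"
        using eq[OF iv_closed[OF that(2)] iv_closed[OF that(1)]] that by (simp only: iv_iv homeo)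
      then show ?thesis using iv_closed[OF that(1)] iv_closed[OF that(2)] by (intro UN_I) (rule singletonI | simp)+
    qed
    moreover have "?L \<subseteq> ?R"
    proof
      fix x assume "x \<in> ?L"
      then obtain g h where "g \<in> G" "h \<in> G" "x = commutator (iv h) (iv g)" using eq by (elim UN_E) simp
      then show "x \<in> ?R" using iv_closed by blast
    qed
    ultimately show ?thesis by (intro equalityI) auto
  qed
  then show ?thesis by (simp add: derived_def)
qed

lemma commutators_subset: "{commutator g h |g h. g \<in> G \<and> h \<in> G} \<subseteq> G"
  using commutator_closed by auto

lemma commutator_in_derived: "g \<in> G \<Longrightarrow> h \<in> G \<Longrightarrow> commutator g h \<in> derived (gp G) G"
  unfolding derived_eq by (auto intro: generate.incl)

lemma derived_subset: "derived (gp G) G \<subseteq> G"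
  unfolding derived_eq using commutators_subset by (rule generate_subset)

lemma derived_subgroup: "homeo_subgroup (derived (gp G) G)"
  unfolding derived_eq using commutators_subset by (rule generate_subgroup)

lemma derived_least:
  assumes "\<And>g h. g \<in> G \<Longrightarrow> h \<in> G \<Longrightarrow> commutator g h \<in> N" "homeo_subgroup N"
  shows "derived (gp G) G \<subseteq> N"
  unfolding derived_eq using assms commutators_subset by (intro generate_least) auto

lemma derived_conj_closed:
  assumes "k \<in> carrier homeo_group" "\<And>g. g \<in> G \<Longrightarrow> conj_by k g \<in> G" "g \<in> derived (gp G) G"
  shows "conj_by k g \<in> derived (gp G) G"
proof -
  have "conj_by k s \<in> {commutator g h |g h. g \<in> G \<and> h \<in> G}"
    if s: "s \<in> {commutator g h |g h. g \<in> G \<and> h \<in> G}" for s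
  proof -
    obtain g h where gh: "g \<in> G" "h \<in> G" "s = commutator g h" using s by blast
    then have "conj_by k s = commutator (conj_by k g) (conj_by k h)"
      using conj_by_commutator[OF assms(1)] by simp
    then show ?thesis using assms(2) gh by blast
  qed
  then show ?thesis
    using generate_conj_closed[OF commutators_subset assms(1)] assms(3) unfolding derived_eq by blast
qed

lemma rist_comp: "g \<in> rist G A \<Longrightarrow> h \<in> rist G A \<Longrightarrow> g \<circ> h \<in> rist G A"
  by (simp add: rist_def comp_closed supp_subset_iff)

lemma rist_id [simp]: "id \<in> rist G A"
  by (simp add: rist_def supp_def)

lemma rist_iv: "g \<in> rist G A \<Longrightarrow> iv g \<in> rist G A"
  by (auto simp: rist_def iv_closed supp_subset_iff intro: iv_eqI)

text \<open>If \<open>g x\<close> lay outside \<open>A\<close> it would be fixed by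
  \<open>g\<close>, and injectivity would force \<open>g x = x\<close>, which is in
  \<open>A\<close>.\<close>

lemma rist_maps: "g \<in> rist G A \<Longrightarrow> x \<in> A \<Longrightarrow> g x \<in> A"
  by (metis (no_types, lifting) homeo homeo_eq_iff rist_outside rist_subset subsetD)

lemma rist_image: "g \<in> rist G A \<Longrightarrow> U \<subseteq> A \<Longrightarrow> g ` U \<subseteq> A"
  using rist_maps by blast

lemma rist_conj:
  assumes "g \<in> rist G A" "k \<in> carrier homeo_group" "conj_by k g \<in> G"
  shows "conj_by k g \<in> rist G (k ` A)"
  unfolding rist_def supp_subset_iff
proof (intro CollectI conjI allI impI assms(3))
  fix x assume "x \<notin> k ` A"
  then have "iv k x \<notin> A" using assms(2) by (metis image_eqI iv_cancel(2))
  then show "conj_by k g x = x"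
    using rist_outside[OF assms(1)] assms(2) by (simp add: conj_by_def)
qed

lemma rist_homeo [simp]: "g \<in> rist G A \<Longrightarrow> g \<in> carrier homeo_group"
  using rist_subset by blast

lemma small_elements_subset: "small_elements G \<subseteq> G"
  by (auto simp: small_elements_def)

lemma small_elements_iv: "g \<in> small_elements G \<Longrightarrow> iv g \<in> small_elements G"
  using rist_iv by (auto simp: small_elements_iff)

lemma small_elements_conj:
  assumes "k \<in> carrier homeo_group" "\<And>g. g \<in> G \<Longrightarrow> conj_by k g \<in> G" "g \<in> small_elements G"
  shows "conj_by k g \<in> small_elements G"
proof -
  obtain A where A: "A \<in> K_C" "g \<in> rist G A" using assms(3) by (auto simp: small_elements_iff)
  have "k ` A \<noteq> UNIV"
    using A(1) homeo_bij[OF assms(1)] unfolding K_C_def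
    by (metis (mono_tags, lifting) bij_is_inj bij_is_surj inj_image_eq_iff mem_Collect_eq)
  then have "k ` A \<in> K_C" using A(1) assms(1) by (auto simp: K_C_def clopen_homeo_image)
  moreover have "conj_by k g \<in> rist G (k ` A)"
    using A assms rist_subset by (intro rist_conj) auto
  ultimately show ?thesis by (auto simp: small_elements_iff)
qed

lemma gen_small_support_iff:
  "gen_small_support G \<longleftrightarrow> G \<subseteq> generate (gp G) (small_elements G)"
  unfolding gen_small_support_def small_elements_def[symmetric]
  using generate_subset[OF small_elements_subset] by blast

end

section \<open>The full group\<close>

context homeo_subgroup
begin

text \<open>By compactness, local agreement with elements of \<open>G\<close> already yields a
  finite clopen partition. The local form makes closure under products, inverses and gluing easy to
  verify.\<close>

lemma full_group_iff:
  "h \<in> full_group G \<longleftrightarrow> h \<in> carrier homeo_group \<and>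
     (\<forall>p. \<exists>U. clopen_set U \<and> p \<in> U \<and> (\<exists>g\<in>G. \<forall>x\<in>U. h x = g x))"
    (is "_ \<longleftrightarrow> _ \<and> ?loc")
proof (intro iffI conjI)
  assume "h \<in> carrier homeo_group \<and> ?loc"
  then have h: "h \<in> carrier homeo_group" and loc: ?loc by auto
  define R where "R U \<longleftrightarrow> (\<exists>P. finite P \<and> (\<forall>D\<in>P. clopen_set D) \<and>
        (\<forall>D\<in>P. \<forall>D'\<in>P. D \<noteq> D' \<longrightarrow> D \<inter> D' = {}) \<and> \<Union>P = U \<and>
        (\<forall>D\<in>P. \<exists>g\<in>G. \<forall>p\<in>D. h p = g p))" for U
  have "R UNIV"
  proof (rule clopen_local_induct[OF clopen_UNIV])
    fix p
    obtain V where V: "clopen_set V" "p \<in> V" "\<exists>g\<in>G. \<forall>x\<in>V. h x = g x" using loc by blast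
    then have "R V" unfolding R_def by (intro exI[of _ "{V}"]) auto
    with V show "\<exists>V. clopen_set V \<and> p \<in> V \<and> R V" by blast
  next
    fix V W assume VW: "clopen_set V" "clopen_set W" "V \<subseteq> W" "R W"
    then obtain P where P: "finite P" "\<forall>D\<in>P. clopen_set D"
        "\<forall>D\<in>P. \<forall>D'\<in>P. D \<noteq> D' \<longrightarrow> D \<inter> D' = {}" "\<Union>P = W"
        "\<forall>D\<in>P. \<exists>g\<in>G. \<forall>p\<in>D. h p = g p"
      unfolding R_def by blast
    show "R V" unfolding R_def
    proof (intro exI[of _ "(\<lambda>D. D \<inter> V) ` P"] conjI)
      show "\<forall>D\<in>(\<lambda>D. D \<inter> V) ` P. \<forall>D'\<in>(\<lambda>D. D \<inter> V) ` P. D \<noteq> D' \<longrightarrow> D \<inter> D' = {}"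
        using P(3) by blast
      show "\<forall>D\<in>(\<lambda>D. D \<inter> V) ` P. \<exists>g\<in>G. \<forall>p\<in>D. h p = g p" using P(5) by fastforce
    qed (use P VW in \<open>auto intro: clopen_intros\<close>)
  next
    fix V W assume VW: "V \<inter> W = {}" "R V" "R W"
    obtain P where P: "finite P" "\<forall>D\<in>P. clopen_set D"
        "\<forall>D\<in>P. \<forall>D'\<in>P. D \<noteq> D' \<longrightarrow> D \<inter> D' = {}" "\<Union>P = V"
        "\<forall>D\<in>P. \<exists>g\<in>G. \<forall>p\<in>D. h p = g p"
      using VW(2) unfolding R_def by blast
    obtain Q where Q: "finite Q" "\<forall>D\<in>Q. clopen_set D"
        "\<forall>D\<in>Q. \<forall>D'\<in>Q. D \<noteq> D' \<longrightarrow> D \<inter> D' = {}" "\<Union>Q = W"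
        "\<forall>D\<in>Q. \<exists>g\<in>G. \<forall>p\<in>D. h p = g p"
      using VW(3) unfolding R_def by blast
    have cross: "D \<inter> D' = {}" if "D \<in> P" "D' \<in> Q" for D D'
      using that P(4) Q(4) VW(1) by blast
    show "R (V \<union> W)" unfolding R_def
    proof (intro exI[of _ "P \<union> Q"] conjI ballI impI)
      fix D D' assume "D \<in> P \<union> Q" "D' \<in> P \<union> Q" "D \<noteq> D'"
      then show "D \<inter> D' = {}"
        using P(3) Q(3) cross[of D D'] cross[of D' D] by (elim UnE) (simp_all add: Int_commute)
    qed (use P Q in auto)
  next
    show "R {}" unfolding R_def by (intro exI[of _ "{}"]) auto
  qed
  with h show "h \<in> full_group G" unfolding full_group_def R_def by blast
next
  assume "h \<in> full_group G"
  then show "h \<in> carrier homeo_group" by (simp add: full_group_def)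
  from \<open>h \<in> full_group G\<close> obtain P where P: "\<forall>D\<in>P. clopen_set D" "\<Union>P = UNIV"
      "\<forall>D\<in>P. \<exists>g\<in>G. \<forall>p\<in>D. h p = g p"
    unfolding full_group_def mem_Collect_eq by (elim conjE exE) iprover
  show ?loc
  proof
    fix p
    have "p \<in> \<Union>P" by (simp add: P(2))
    then obtain D where "D \<in> P" "p \<in> D" by (rule UnionE)
    then show "\<exists>U. clopen_set U \<and> p \<in> U \<and> (\<exists>g\<in>G. \<forall>x\<in>U. h x = g x)"
      using P(1,3) by (intro exI[of _ D]) simp
  qed
qed

lemma full_groupD:
  assumes "h \<in> full_group G"
  obtains U g where "clopen_set U" "p \<in> U" "g \<in> G" "\<And>x. x \<in> U \<Longrightarrow> h x = g x"
  using assms unfolding full_group_iff by blast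

lemma subset_full_group: "G \<subseteq> full_group G"
  unfolding full_group_iff subset_iff using clopen_UNIV homeo by blast

lemma full_group_homeo [simp]: "h \<in> full_group G \<Longrightarrow> h \<in> carrier homeo_group"
  by (simp add: full_group_iff)

lemma full_groupI:
  assumes "bij h"
    and "\<And>p. \<exists>U g. clopen_set U \<and> p \<in> U \<and> g \<in> G \<and> (\<forall>x\<in>U. h x = g x)"
  shows "h \<in> full_group G"
proof -
  have "h \<in> carrier homeo_group"
    by (rule homeo_locally[OF assms(1)]) (use assms(2) homeo in meson)
  then show ?thesis using assms(2) unfolding full_group_iff by blast
qed

lemma full_group_comp:
  assumes f: "f \<in> full_group G" and h: "h \<in> full_group G"
  shows "f \<circ> h \<in> full_group G"
proof (rule full_groupI)
  show "bij (f \<circ> h)" using f h by (intro bij_comp homeo_bij) auto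
  fix p
  obtain U g where U: "clopen_set U" "p \<in> U" "g \<in> G" "\<And>x. x \<in> U \<Longrightarrow> h x = g x"
    using full_groupD[OF h, of p] by metis
  obtain V k where V: "clopen_set V" "h p \<in> V" "k \<in> G" "\<And>x. x \<in> V \<Longrightarrow> f x = k x"
    using full_groupD[OF f, of "h p"] by metis
  have "clopen_set (U \<inter> h -` V)"
    using U V h by (intro clopen_Int clopen_homeo_vimage) auto
  then show "\<exists>U g. clopen_set U \<and> p \<in> U \<and> g \<in> G \<and> (\<forall>x\<in>U. (f \<circ> h) x = g x)"
    using U V comp_closed[OF V(3) U(3)] by (intro exI[of _ "U \<inter> h -` V"] exI[of _ "k \<circ> g"]) auto
qed

lemma full_group_iv:
  assumes h: "h \<in> full_group G"
  shows "iv h \<in> full_group G"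
proof (rule full_groupI)
  show "bij (iv h)" using h by (intro bij_imp_bij_inv homeo_bij) auto
  fix p
  obtain U g where U: "clopen_set U" "iv h p \<in> U" "g \<in> G" "\<And>x. x \<in> U \<Longrightarrow> h x = g x"
    using full_groupD[OF h, of "iv h p"] by metis
  have "clopen_set (h ` U)" using U(1) h by (simp add: clopen_homeo_image)
  moreover have "p \<in> h ` U" using U(2) h by (intro image_eqI[of _ _ "iv h p"]) auto
  moreover have "iv h x = iv g x" if x: "x \<in> h ` U" for x
  proof -
    obtain y where y: "y \<in> U" "x = h y" using x by blast
    then have "iv h x = y" using h by simp
    moreover have "iv g x = y" using y U(3,4) by (intro iv_eqI) auto
    ultimately show ?thesis by simp
  qed
  ultimately show "\<exists>U g. clopen_set U \<and> p \<in> U \<and> g \<in> G \<and> (\<forall>x\<in>U. iv h x = g x)"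
    using iv_closed[OF U(3)] by blast
qed

lemma full_group_subgroup: "homeo_subgroup (full_group G)"
proof (rule homeo_subgroup.intro)
  show "subgroup (full_group G) homeo_group"
  proof (rule subgroup.intro)
    show "\<one>\<^bsub>homeo_group\<^esub> \<in> full_group G" unfolding homeo_one using subset_full_group id_closed by blast
    fix f h assume "f \<in> full_group G" "h \<in> full_group G"
    then show "f \<otimes>\<^bsub>homeo_group\<^esub> h \<in> full_group G" unfolding homeo_mult by (rule full_group_comp[rotated])
  next
    fix f assume "f \<in> full_group G"
    then show "m_inv homeo_group f \<in> full_group G" using full_group_iv homeo_m_inv by simp
  qed (rule subsetI, rule full_group_homeo)
qed

end

section \<open>Vigorous groups and elements of small support\<close>

locale vigorous_group = homeo_subgroup +
  assumes vigorous: "vigorous G"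
begin

lemma vigorous_rist:
  assumes "clopen_set A" "clopen_set B" "clopen_set C" "B \<noteq> {}" "B \<subset> A" "C \<noteq> {}" "C \<subset> A"
  obtains k where "k \<in> rist G A" "k ` B \<subseteq> C"
proof -
  have "\<exists>k\<in>G. supp k \<subseteq> A \<and> k ` B \<subseteq> C"
    using vigorous assms unfolding vigorous_def by blast
  then show ?thesis using that unfolding rist_def by blast
qed

text \<open>Vigour compresses \<open>A - C\<close>, which contains \<open>p\<close>, into a set
  \<open>C\<close> chosen to avoid \<open>p\<close> and \<open>F\<close>.\<close>

lemma rist_moves_off:
  assumes A: "clopen_set A" "p \<in> A" and F: "finite F"
  obtains g where "g \<in> rist G A" "g p \<notin> insert p F"
proof -
  have "finite (insert p F)" using F by simp
  then obtain C where C: "clopen_set C" "C \<noteq> {}" "C \<subset> A" "C \<inter> insert p F = {}"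
    using clopen_proper_part[OF A(1), of "insert p F"] A(2) by blast
  obtain k where "k \<in> rist G A" "k ` (A - C) \<subseteq> C"
    using vigorous_rist[of A "A - C" C] A C by (auto intro: clopen_intros)
  then show ?thesis using that[of k] A C by blast
qed

text \<open>Conjugate \<open>s\<close> by an element that fixes \<open>U\<close> and its image
  pointwise and pushes the rest of \<open>A\<close> into \<open>E\<close>: the action on
  \<open>U\<close> is unchanged, and the support ends up in \<open>E\<close>.\<close>

lemma shrink_support:
  assumes s: "s \<in> rist G A" and A: "clopen_set A" "A \<noteq> UNIV"
    and U: "clopen_set U" "U \<subseteq> A" and E: "clopen_set E" "U \<union> s ` U \<subset> E"
  shows "\<exists>c\<in>rist G E. \<forall>x\<in>U. c x = s x"
proof -
  define M where "M = U \<union> s ` U"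
  have sG: "s \<in> G" using s rist_subset by blast
  have M: "clopen_set M" "M \<subseteq> A" "M \<subset> E"
    using U sG unfolding M_def
    by (intro clopen_Un clopen_homeo_image homeo) (use U E rist_image[OF s U(2)] in auto)
  \<comment> \<open>In the first two cases \<open>s\<close> is already supported in
    \<open>E\<close>. In the third, \<open>A - M\<close> and \<open>E - M\<close> are nonempty
    proper subsets of \<open>- M\<close>, the form in which vigour applies.\<close>
  consider "A \<subseteq> M" | "E = UNIV" | "\<not> A \<subseteq> M" "E \<noteq> UNIV" by blast
  then show ?thesis
  proof cases
    case 1
    then have "s \<in> rist G E" using s rist_mono[of A E G] M by blast
    then show ?thesis by blast
  next
    case 2
    then have "s \<in> rist G E" using s rist_mono[of A E G] by blast
    then show ?thesis by blast
  next
    case 3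
    obtain k where k: "k \<in> rist G (- M)" "k ` (A - M) \<subseteq> E - M"
      by (rule vigorous_rist[of "- M" "A - M" "E - M"])
        (use 3 A E M in \<open>auto intro: clopen_intros\<close>)
    have kG: "k \<in> G" using k rist_subset by blast
    have fixM: "k x = x" "iv k x = x" if "x \<in> M" for x
      using that rist_outside[OF k(1)] rist_outside[OF rist_iv[OF k(1)]] by auto
    have "conj_by k s \<in> rist G E"
      unfolding rist_def supp_subset_iff
    proof (intro CollectI conjI conj_closed kG sG allI impI)
      fix x assume x: "x \<notin> E"
      have "iv k x \<notin> A"
      proof
        assume "iv k x \<in> A"
        moreover have "iv k x \<notin> M"
          using fixM(1)[of "iv k x"] x M(3) kG by auto
        ultimately have "k (iv k x) \<in> E - M" using k(2) by blast
        then show False using x kG by simp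
      qed
      then show "conj_by k s x = x"
        using rist_outside[OF s] kG by (simp add: conj_by_def)
    qed
    moreover have "\<forall>x\<in>U. conj_by k s x = s x"
      using fixM by (simp add: conj_by_def M_def)
    ultimately show ?thesis by blast
  qed
qed

lemma shrink_support_germ:
  assumes s: "s \<in> rist G A" and A: "A \<in> K_C" and E: "clopen_set E" "p \<in> E" "s p \<in> E"
  shows "\<exists>c\<in>rist G E. \<exists>V. clopen_set V \<and> p \<in> V \<and> (\<forall>x\<in>V. c x = s x)"
proof (cases "p \<in> A")
  case False
  have "clopen_set (- A)" using A by (auto simp: K_C_def intro: clopen_intros)
  then show ?thesis
    using False rist_outside[OF s] by (intro bexI[of _ id] exI[of _ "- A"]) auto
next
  case True
  have sG: "s \<in> G" using s rist_subset by blast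
  have cA: "clopen_set A" "A \<noteq> UNIV" using A by (auto simp: K_C_def)
  \<comment> \<open>The point \<open>q\<close> is kept out of the neighbourhood \<open>V\<close> and
    of its image, which makes their union a proper subset of \<open>E\<close>.\<close>
  obtain q where q: "q \<in> E" "q \<noteq> p" "q \<noteq> s p"
    using clopen_infinite[OF E(1)] E(2)
    by (metis empty_iff finite.emptyI finite.insertI insert_iff rev_finite_subset subsetI)
  have "p \<notin> {q, iv s q}" using q sG by auto
  then obtain W where W: "clopen_set W" "p \<in> W" "W \<inter> {q, iv s q} = {}"
    using clopen_separates[of "{q, iv s q}" p] by auto
  define V where "V = (W \<inter> A) \<inter> (E \<inter> s -` E)"
  have V: "clopen_set V" "p \<in> V" "V \<subseteq> A"
    using W cA E True sG unfolding V_def by (auto intro!: clopen_Int clopen_homeo_vimage)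
  have "q \<notin> s ` V" using W sG by (auto simp: V_def)
  then have "V \<union> s ` V \<subset> E" using q W by (auto simp: V_def)
  then show ?thesis using shrink_support[OF s cA V(1,3) E(1)] V by blast
qed

text \<open>For a product, the germs of both factors are first shrunk into one proper clopen set
  \<open>E\<close> containing \<open>p\<close> and its two successive images; the product of the
  shrunken elements is then small and has the right germ.\<close>

lemma locally_small:
  assumes "gen_small_support G" "g \<in> G"
  shows "\<exists>s\<in>small_elements G. \<exists>U. clopen_set U \<and> p \<in> U \<and> (\<forall>x\<in>U. g x = s x)"
proof -
  have "g \<in> generate (gp G) (small_elements G)"
    using assms by (auto simp: gen_small_support_iff)
  then show ?thesis
  proof (induction arbitrary: p)
    case one
    obtain A where "A \<in> K_C"
      using clopen_proper_part[OF clopen_UNIV UNIV_not_empty, of "{}"] unfolding K_C_def by blast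
    then have "id \<in> small_elements G" unfolding small_elements_iff using rist_id by blast
    then show ?case unfolding gp_simps using clopen_UNIV by blast
  next
    case (incl h)
    then show ?case using clopen_UNIV by blast
  next
    case (inv h)
    then have "m_inv (gp G) h = iv h" using small_elements_subset by auto
    then show ?case
      using small_elements_iv[OF inv] by (intro bexI[of _ "iv h"] exI[of _ UNIV]) simp_all
  next
    case (eng h1 h2)
    have h: "h1 \<in> G"
      using eng.hyps generate_subset[OF small_elements_subset] by blast
    \<comment> \<open>A neighbourhood of \<open>r\<close> is left out of \<open>E\<close>, so that
      \<open>E\<close> is proper.\<close>
    obtain r where r: "r \<notin> {p, h1 p, h2 (h1 p)}"
      using ex_new_if_finite[OF clopen_infinite[OF clopen_UNIV UNIV_not_empty], of "{p, h1 p, h2 (h1 p)}"]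
      by auto
    then obtain W where W: "clopen_set W" "r \<in> W" "W \<inter> {p, h1 p, h2 (h1 p)} = {}"
      using clopen_separates[of "{p, h1 p, h2 (h1 p)}" r] by auto
    define E where "E = - W"
    have E: "clopen_set E" "p \<in> E" "h1 p \<in> E" "h2 (h1 p) \<in> E" "E \<in> K_C"
      using W by (auto simp: E_def K_C_def intro: clopen_intros)
    obtain s1 U1 where U1: "s1 \<in> small_elements G" "clopen_set U1" "p \<in> U1" "\<forall>x\<in>U1. h1 x = s1 x"
      using eng.IH(1)[of p] by blast
    then obtain A1 where "s1 \<in> rist G A1" "A1 \<in> K_C" unfolding small_elements_iff by blast
    note 1 = this U1(2-4)
    obtain s2 U2 where U2: "s2 \<in> small_elements G" "clopen_set U2" "h1 p \<in> U2" "\<forall>x\<in>U2. h2 x = s2 x"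
      using eng.IH(2)[of "h1 p"] by blast
    then obtain A2 where "s2 \<in> rist G A2" "A2 \<in> K_C" unfolding small_elements_iff by blast
    note 2 = this U2(2-4)
    obtain c1 V1 where c1: "c1 \<in> rist G E" "clopen_set V1" "p \<in> V1" "\<forall>x\<in>V1. c1 x = s1 x"
      using shrink_support_germ[OF 1(1,2) E(1,2)] 1 E by auto
    obtain c2 V2 where c2: "c2 \<in> rist G E" "clopen_set V2" "h1 p \<in> V2" "\<forall>x\<in>V2. c2 x = s2 x"
      using shrink_support_germ[OF 2(1,2) E(1,3)] 2 E by auto
    define V where "V = (U1 \<inter> V1) \<inter> h1 -` (U2 \<inter> V2)"
    have "clopen_set V"
      unfolding V_def using 1 2 c1 c2 h by (intro clopen_Int clopen_homeo_vimage) auto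
    moreover have "p \<in> V" using 1 2 c1 c2 by (auto simp: V_def)
    moreover have "\<forall>x\<in>V. (h2 \<circ> h1) x = (c2 \<circ> c1) x"
      using 1 2 c1 c2 by (auto simp: V_def)
    moreover have "c2 \<circ> c1 \<in> small_elements G"
      using rist_comp[OF c2(1) c1(1)] E(5) by (auto simp: small_elements_iff)
    ultimately show ?case unfolding gp_simps by blast
  qed
qed

text \<open>Pieces of \<open>U\<close> are treated by elements with pairwise disjoint supports, each
  consisting of a piece, its image and a private part of \<open>E - (U \<union> f ` U)\<close>.\<close>
lemma extend_disjoint:
  assumes gen: "gen_small_support G" and f: "f \<in> full_group G"
    and U: "clopen_set U" "U \<inter> f ` U = {}" and E: "clopen_set E" "U \<union> f ` U \<subset> E"
  shows "\<exists>c\<in>rist G E. \<forall>x\<in>U. c x = f x"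
proof -
  \<comment> \<open>Quantifying over subsets \<open>V\<close> makes \<open>R\<close> hereditary;
    quantifying over \<open>E\<close> lets the union step hand each piece its own share of the
    room.\<close>
  define R where "R W \<longleftrightarrow> (\<forall>V E. V \<subseteq> W \<and> clopen_set V \<and> V \<inter> f ` V = {} \<and> clopen_set E \<and>
      V \<union> f ` V \<subset> E \<longrightarrow> (\<exists>c\<in>rist G E. \<forall>x\<in>V. c x = f x))" for W
  have "R U"
  proof (rule clopen_local_induct[OF U(1)])
    fix p assume p: "p \<in> U"
    obtain V g where V: "clopen_set V" "p \<in> V" "g \<in> G" "\<And>x. x \<in> V \<Longrightarrow> f x = g x"
      using full_groupD[OF f, of p] by metis
    obtain s W where W: "s \<in> small_elements G" "clopen_set W" "p \<in> W" "\<forall>x\<in>W. g x = s x"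
      using locally_small[OF gen V(3), of p] by blast
    then obtain A where "s \<in> rist G A" "A \<in> K_C" unfolding small_elements_iff by blast
    note s = this W(2-4)
    have A: "clopen_set A" "A \<noteq> UNIV" using s(2) by (auto simp: K_C_def)
    have "f p \<noteq> p" using U(2) p by force
    then have "p \<in> A" using rist_outside[OF s(1), of p] s V by auto
    then have "p \<in> A \<inter> (V \<inter> W)" using V s by auto
    moreover have "clopen_set (A \<inter> (V \<inter> W))" using A V s by (auto intro: clopen_intros)
    moreover have "R (A \<inter> (V \<inter> W))"
      unfolding R_def
    proof (intro allI impI; elim conjE)
      fix Y E assume Y: "Y \<subseteq> A \<inter> (V \<inter> W)" "clopen_set Y" and E: "clopen_set E" "Y \<union> f ` Y \<subset> E"
      have eq: "f x = s x" if "x \<in> Y" for x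
      proof -
        have "x \<in> V" "x \<in> W" using that Y(1) by auto
        then show ?thesis using V(4) s(5) by simp
      qed
      then have "f ` Y = s ` Y" by auto
      then show "\<exists>c\<in>rist G E. \<forall>x\<in>Y. c x = f x"
        using shrink_support[OF s(1) A Y(2) _ E(1)] Y(1) E(2) eq by auto
    qed
    ultimately show "\<exists>V. clopen_set V \<and> p \<in> V \<and> R V" by blast
  next
    fix V W assume VW: "V \<subseteq> W" "R W"
    show "R V" unfolding R_def
    proof (intro allI impI; elim conjE)
      fix Y E assume "Y \<subseteq> V" "clopen_set Y" "Y \<inter> f ` Y = {}" "clopen_set E" "Y \<union> f ` Y \<subset> E"
      then show "\<exists>c\<in>rist G E. \<forall>x\<in>Y. c x = f x"
        by (intro VW(2)[unfolded R_def, rule_format] conjI) (use VW(1) in auto)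
    qed
  next
    fix V W assume VW: "clopen_set V" "clopen_set W" "V \<inter> W = {}" "R V" "R W"
    show "R (V \<union> W)" unfolding R_def
    proof (intro allI impI; elim conjE)
      fix Y E assume Y: "Y \<subseteq> V \<union> W" "clopen_set Y" "Y \<inter> f ` Y = {}"
        and E: "clopen_set E" "Y \<union> f ` Y \<subset> E"
      have fY: "clopen_set (f ` Y)" using f Y(2) by (simp add: clopen_homeo_image)
      \<comment> \<open>The free room splits into \<open>T\<close> for the first piece and a
        nonempty remainder for the second, so both inclusions stay strict.\<close>
      obtain T where T: "clopen_set T" "T \<noteq> {}" "T \<subset> E - (Y \<union> f ` Y)"
      proof -
        have "clopen_set (E - (Y \<union> f ` Y))" using E(1) Y(2) fY by (intro clopen_Diff clopen_Un)
        moreover have "E - (Y \<union> f ` Y) \<noteq> {}" using E(2) by blast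
        ultimately show ?thesis
          using clopen_proper_part[of "E - (Y \<union> f ` Y)" "{}"] that by blast
      qed
      define Y1 Y2 where "Y1 = Y \<inter> V" and "Y2 = Y \<inter> W"
      define A1 A2 where "A1 = Y1 \<union> f ` Y1" and "A2 = Y2 \<union> f ` Y2"
      define E1 E2 where "E1 = A1 \<union> T" and "E2 = A2 \<union> (E - (A1 \<union> A2) - T)"
      have YY: "Y = Y1 \<union> Y2" "Y1 \<inter> Y2 = {}" "Y1 \<subseteq> V" "Y2 \<subseteq> W"
        using Y(1) VW(3) by (auto simp: Y1_def Y2_def)
      have c: "clopen_set Y1" "clopen_set Y2" "clopen_set A1" "clopen_set A2"
        using Y VW f unfolding Y1_def Y2_def A1_def A2_def
        by (simp_all add: clopen_Int clopen_Un clopen_homeo_image)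
      then have cE: "clopen_set E1" "clopen_set E2"
        using T(1) E(1) unfolding E1_def E2_def by (simp_all add: clopen_Un clopen_Diff)
      have A12: "A1 \<union> A2 = Y \<union> f ` Y" unfolding A1_def A2_def YY(1) image_Un by blast
      have "f ` Y1 \<inter> f ` Y2 = {}" using YY(2) f homeo_eq_iff[of f] by auto
      moreover have disj: "Y1 \<inter> f ` Y1 = {}" "Y2 \<inter> f ` Y2 = {}" "Y1 \<inter> f ` Y2 = {}" "Y2 \<inter> f ` Y1 = {}"
        using Y(3) YY(1) by auto
      ultimately have "A1 \<inter> A2 = {}"
        using YY(2) unfolding A1_def A2_def by (simp add: Int_Un_distrib Int_Un_distrib2 Int_commute)
      moreover have "T \<subset> E - (A1 \<union> A2)" "A1 \<union> A2 \<subseteq> E" using T(3) E(2) unfolding A12 by blast+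
      ultimately have E12: "E1 \<inter> E2 = {}" "E1 \<subseteq> E" "E2 \<subseteq> E" and sub: "A1 \<subset> E1" "A2 \<subset> E2"
        using T(2) unfolding E1_def E2_def by blast+
      have "\<exists>c\<in>rist G E1. \<forall>x\<in>Y1. c x = f x"
        by (rule VW(4)[unfolded R_def, rule_format])
          (intro conjI YY(3) c(1) disj(1) cE(1) sub(1)[unfolded A1_def])
      then obtain c1 where c1: "c1 \<in> rist G E1" "\<forall>x\<in>Y1. c1 x = f x" by blast
      have "\<exists>c\<in>rist G E2. \<forall>x\<in>Y2. c x = f x"
        by (rule VW(5)[unfolded R_def, rule_format])
          (intro conjI YY(4) c(2) disj(2) cE(2) sub(2)[unfolded A2_def])
      then obtain c2 where c2: "c2 \<in> rist G E2" "\<forall>x\<in>Y2. c2 x = f x" by blast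
      \<comment> \<open>The factors do not interfere: \<open>c2\<close> is trivial on
        \<open>Y1\<close>, and \<open>c1\<close> is trivial on the image of
        \<open>Y2\<close>.\<close>
      have "c1 \<circ> c2 \<in> rist G E"
        using c1(1) c2(1) rist_mono[OF E12(2), of G] rist_mono[OF E12(3), of G]
        by (intro rist_comp) auto
      moreover have "(c1 \<circ> c2) x = f x" if x: "x \<in> Y" for x
      proof (cases "x \<in> Y1")
        case True
        then have "x \<notin> E2" using E12(1) sub(1) unfolding A1_def by blast
        then show ?thesis using True c1(2) rist_outside[OF c2(1)] by simp
      next
        case False
        then have x: "x \<in> Y2" using x YY(1) by blast
        then have "f x \<in> A2" unfolding A2_def by blast
        then have "f x \<notin> E1" using E12(1) sub(2) by blast
        then show ?thesis using x c2(2) rist_outside[OF c1(1)] by simp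
      qed
      ultimately show "\<exists>c\<in>rist G E. \<forall>x\<in>Y. c x = f x" by blast
    qed
  next
    show "R {}" unfolding R_def using rist_id by (metis empty_iff subset_empty)
  qed
  then show ?thesis
    by (rule R_def[THEN iffD1, rule_format]) (intro conjI order_refl U E)
qed

text \<open>If \<open>U\<close> meets its image, first move \<open>U\<close> by some
  \<open>a\<close> in \<open>G\<close> to a place in \<open>E\<close> disjoint from that image. Then
  \<open>f \<circ> iv a\<close> displaces the moved set, and composing its extension with
  \<open>a\<close> gives the required element.\<close>

lemma extend:
  assumes gen: "gen_small_support G" and f: "f \<in> full_group G"
    and U: "clopen_set U" and E: "clopen_set E" "U \<subset> E" "f ` U \<subset> E"
  shows "\<exists>c\<in>rist G E. \<forall>x\<in>U. c x = f x"
proof (cases "U = {}")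
  case True
  then show ?thesis using rist_id by blast
next
  case False
  have fU: "clopen_set (f ` U)" using f U by (simp add: clopen_homeo_image)
  have "clopen_set (E - f ` U)" "E - f ` U \<noteq> {}" using E fU by (auto intro: clopen_intros)
  then obtain C where C: "clopen_set C" "C \<noteq> {}" "C \<subset> E - f ` U"
    using clopen_proper_part[of "E - f ` U" "{}"] by blast
  obtain a where a: "a \<in> rist G E" "a ` U \<subseteq> C"
    by (rule vigorous_rist[of E U C]) (use False U E C in auto)
  have aG: "a \<in> G" using a rist_subset by blast
  have img: "(f \<circ> iv a) ` (a ` U) = f ` U" using aG by (simp add: image_comp comp_def)
  have "f \<circ> iv a \<in> full_group G"
    using f aG iv_closed subset_full_group by (intro full_group_comp) auto
  moreover have "clopen_set (a ` U)" using U aG by (simp add: clopen_homeo_image)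
  moreover have "a ` U \<inter> f ` U = {}" "a ` U \<union> f ` U \<subset> E"
    using E(3) C(2,3) a(2) by blast+
  ultimately have "\<exists>c\<in>rist G E. \<forall>x\<in>a ` U. c x = (f \<circ> iv a) x"
    by (intro extend_disjoint[OF gen _ _ _ E(1)]) (simp_all only: img)
  then obtain c where c: "c \<in> rist G E" "\<forall>x\<in>a ` U. c x = (f \<circ> iv a) x" by blast
  have "c \<circ> a \<in> rist G E" using c a by (intro rist_comp)
  moreover have "\<forall>x\<in>U. (c \<circ> a) x = f x" using c aG by simp
  ultimately show ?thesis by blast
qed

end

section \<open>Subgroups normalised by a vigorous group\<close>

lemma iv_commutator:
  assumes "g \<in> carrier homeo_group" "h \<in> carrier homeo_group"
  shows "iv (commutator g h) = commutator h g"
  using assms by (simp add: commutator_def iv_comp iv_iv homeo_comp homeo_iv comp_assoc)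

lemma commutator_comp_left:
  assumes "g \<in> carrier homeo_group" "h \<in> carrier homeo_group" "c \<in> carrier homeo_group"
  shows "commutator (g \<circ> h) c = conj_by g (commutator h c) \<circ> commutator g c"
  using assms by (simp add: commutator_def conj_by_def iv_comp fun_eq_iff)

lemma commutator_eq_conj_by: "commutator g h = conj_by g h \<circ> iv h"
  by (simp add: commutator_def conj_by_def)

lemma (in homeo_subgroup) rist_commute:
  assumes "g \<in> rist G A" "h \<in> rist G B" "A \<inter> B = {}"
  shows "g \<circ> h = h \<circ> g"
proof
  fix x
  consider "x \<in> A" "x \<notin> B" | "x \<in> B" "x \<notin> A" | "x \<notin> A" "x \<notin> B" using assms(3) by blast
  then show "(g \<circ> h) x = (h \<circ> g) x"
  proof cases
    case 1
    then have "g x \<notin> B" using rist_maps[OF assms(1)] assms(3) by blast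
    with 1 show ?thesis by (simp add: rist_outside[OF assms(2)])
  next
    case 2
    then have "h x \<notin> A" using rist_maps[OF assms(2)] assms(3) by blast
    with 2 show ?thesis by (simp add: rist_outside[OF assms(1)])
  next
    case 3
    then show ?thesis by (simp add: rist_outside[OF assms(1)] rist_outside[OF assms(2)])
  qed
qed

text \<open>The ambient group is a parameter: \<open>G\<close> itself for simplicity, and the full
  group of \<open>G\<close> for the last equivalence, with \<open>N\<close> equal to
  \<open>G\<close> or a subgroup of it.\<close>

locale normalised_subgroup = vigorous_group + N: homeo_subgroup N for N +
  assumes N_subset: "N \<subseteq> G"
    and N_conj: "k \<in> G \<Longrightarrow> n \<in> N \<Longrightarrow> conj_by k n \<in> N"
    and N_nontrivial: "N \<noteq> {id}"
begin

lemma N_commutator: "g \<in> G \<Longrightarrow> n \<in> N \<Longrightarrow> commutator g n \<in> N"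
  unfolding commutator_eq_conj_by by (intro N.comp_closed N_conj N.iv_closed)

lemma N_commutator': "n \<in> N \<Longrightarrow> g \<in> G \<Longrightarrow> commutator n g \<in> N"
  using N.iv_closed[OF N_commutator, of g n] N_subset
  by (simp add: iv_commutator subset_iff)

text \<open>If \<open>n\<close> moves \<open>U\<close> off itself, then \<open>commutator g n\<close> acts on \<open>U\<close> as \<open>g\<close> does, so its
  commutator with \<open>h\<close> equals that of \<open>g\<close> with \<open>h\<close>.\<close>
lemma commutator_displaced:
  assumes n: "n \<in> N" "U \<inter> n ` U = {}" and gh: "g \<in> rist G U" "h \<in> rist G U"
  shows "commutator g h \<in> N"
proof -
  have G: "n \<in> G" "g \<in> G" "h \<in> G" using n gh N_subset by (auto dest: rist_in)
  define g' where "g' = conj_by n (iv g)"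
  have g': "g' \<in> rist G (n ` U)"
    unfolding g'_def using G gh by (intro rist_conj rist_iv conj_closed iv_closed) auto
  have g'G: "g' \<in> G" using g' rist_subset by blast
  have comm: "g' \<circ> h = h \<circ> g'" using rist_commute[OF g' gh(2)] n(2) by (simp add: Int_commute)
  have eq: "commutator g n = g \<circ> g'" by (simp add: g'_def commutator_def conj_by_def comp_assoc)
  have "commutator (g \<circ> g') h = g \<circ> (g' \<circ> h) \<circ> iv g' \<circ> iv g \<circ> iv h"
    using G g'G by (simp add: commutator_def iv_comp comp_assoc)
  also have "\<dots> = commutator g h"
    unfolding comm using g'G by (simp add: commutator_def fun_eq_iff)
  finally show ?thesis
    using N_commutator'[OF N_commutator[OF G(2) n(1)] G(3)] unfolding eq by simp
qed

text \<open>Some \<open>n\<close> in \<open>N\<close> displaces a nonempty clopen \<open>U\<close>,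
  and vigour compresses \<open>A\<close> into \<open>U\<close>. Conjugation invariance of
  \<open>N\<close> carries the result back to \<open>A\<close>.\<close>

lemma commutator_same_support:
  assumes A: "A \<in> K_C" and gh: "g \<in> rist G A" "h \<in> rist G A"
  shows "commutator g h \<in> N"
proof -
  obtain n where n: "n \<in> N" "n \<noteq> id" using N_nontrivial N.id_closed by blast
  then obtain p where "n p \<noteq> p" by (auto simp: fun_eq_iff)
  then obtain U where U: "clopen_set U" "p \<in> U" "U \<inter> n ` U = {}" "U \<union> n ` U \<noteq> UNIV"
    by (rule displaced_clopen[OF N.homeo[OF n(1)]])
  obtain k where k: "k \<in> rist G UNIV" "k ` A \<subseteq> U"
    by (rule vigorous_rist[of UNIV A U]) (use A U in \<open>auto simp: K_C_def\<close>)
  have G: "k \<in> G" "g \<in> G" "h \<in> G" using k gh by (auto dest: rist_in)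
  have "conj_by k g \<in> rist G U" "conj_by k h \<in> rist G U"
    using rist_conj[OF gh(1), of k] rist_conj[OF gh(2), of k] G conj_closed rist_mono[OF k(2), of G]
    by auto
  then have "conj_by k (commutator g h) \<in> N"
    using commutator_displaced[OF n(1) U(3)] G by (simp add: conj_by_commutator)
  then have "conj_by (iv k) (conj_by k (commutator g h)) \<in> N"
    using G iv_closed N_conj by blast
  moreover have "conj_by (iv k) (conj_by k (commutator g h)) = commutator g h"
    using G by (simp add: conj_by_def fun_eq_iff iv_iv)
  ultimately show ?thesis by simp
qed

text \<open>When the supports cover the space, \<open>g\<close> is first conjugated modulo \<open>N\<close> by an element \<open>k\<close>
  that moves its support away from part of the complement of \<open>B\<close>.\<close>
lemma commutator_small:
  assumes A: "A \<in> K_C" and B: "B \<in> K_C" and g: "g \<in> rist G A" and h: "h \<in> rist G B"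
  shows "commutator g h \<in> N"
proof -
  have union: "commutator g' h' \<in> N"
    if "A' \<in> K_C" "B' \<in> K_C" "A' \<union> B' \<noteq> UNIV" "g' \<in> rist G A'" "h' \<in> rist G B'" for A' B' g' h'
  proof (rule commutator_same_support)
    show "A' \<union> B' \<in> K_C" using that by (auto simp: K_C_def intro: clopen_Un)
    show "g' \<in> rist G (A' \<union> B')" "h' \<in> rist G (A' \<union> B')" using that rist_mono by blast+
  qed
  show ?thesis
  proof (cases "A \<union> B = UNIV")
    case False
    then show ?thesis using union A B g h by blast
  next
    case True
    have cA: "clopen_set (- A)" "- A \<noteq> {}" and cB: "clopen_set (- B)" "- B \<noteq> {}"
      using A B clopen_Compl by (auto simp: K_C_def)
    obtain P where P: "clopen_set P" "P \<noteq> {}" "P \<subset> - A"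
      using clopen_proper_part[OF cA, of "{}"] by blast
    have AB: "- A \<inter> - B = {}" using True by blast
    \<comment> \<open>The part of \<open>- A\<close> outside \<open>P\<close> keeps \<open>D\<close>
      and \<open>A\<close> from covering the space. Since \<open>k\<close> sends \<open>P\<close>
      into \<open>- B\<close>, the image of \<open>A\<close> under \<open>k\<close> and
      \<open>B\<close> do not cover it either.\<close>
    define D where "D = - B \<union> P"
    have D: "clopen_set D" "P \<subset> D" "- B \<subset> D"
      unfolding D_def using P AB cB by (auto intro: clopen_Un)
    obtain k where k: "k \<in> rist G D" "k ` P \<subseteq> - B"
      by (rule vigorous_rist[of D P "- B"]) (use P D cB in auto)
    have G: "k \<in> G" "g \<in> G" "h \<in> G" using k g h by (auto dest: rist_in)
    have DK: "D \<in> K_C" using D(1) P AB unfolding K_C_def D_def by blast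
    have "D \<union> A \<noteq> UNIV" using P(3) AB unfolding D_def by blast
    then have x: "commutator k g \<in> N" using union DK A k(1) g by blast
    have kA: "k ` A \<in> K_C"
      using A G bij_is_inj[OF homeo_bij[OF homeo[OF G(1)]]] bij_is_surj[OF homeo_bij[OF homeo[OF G(1)]]]
      by (auto simp: K_C_def clopen_homeo_image) (metis UNIV_I inj_image_mem_iff UNIV_eq_I)
    obtain z where z: "z \<in> P" using P(2) by blast
    have "k z \<notin> k ` A" using z P(3) homeo_eq_iff[OF homeo[OF G(1)]] by auto
    moreover have "k z \<notin> B" using z k(2) by blast
    ultimately have "k ` A \<union> B \<noteq> UNIV" by blast
    moreover have "conj_by k g \<in> rist G (k ` A)"
      using G g by (intro rist_conj conj_closed) auto
    ultimately have y: "commutator (conj_by k g) h \<in> N" using union kA B h by blast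
    have inv_eqs: "iv (commutator k g) = commutator g k" "iv (conj_by k g) = conj_by k (iv g)"
      using G by (simp_all add: iv_commutator conj_by_iv)
    \<comment> \<open>Substitute \<open>g = iv (commutator k g) \<circ> conj_by k g\<close>: modulo
      \<open>N\<close>, the element \<open>g\<close> may be replaced by its conjugate.\<close>
    have "commutator g h = iv (commutator k g) \<circ> commutator (conj_by k g) h \<circ> conj_by h (commutator k g)"
      unfolding inv_eqs(1) unfolding commutator_def inv_eqs(2)
      using G by (simp add: conj_by_def fun_eq_iff)
    moreover have "iv (commutator k g) \<circ> commutator (conj_by k g) h \<circ> conj_by h (commutator k g) \<in> N"
      by (intro N.comp_closed N.iv_closed N_conj x y G)
    ultimately show ?thesis by simp
  qed
qed

text \<open>With \<open>c\<close> fixed, the product identity for commutators and the invariance of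
  \<open>N\<close> pass from generators to all of \<open>G\<close>.\<close>

lemma commutator_gen:
  assumes gen: "gen_small_support G" and c: "c \<in> G"
    and small: "\<And>s. s \<in> small_elements G \<Longrightarrow> commutator s c \<in> N" and g: "g \<in> G"
  shows "commutator g c \<in> N"
proof -
  have "g \<in> generate (gp G) (small_elements G)"
    using gen g by (auto simp: gen_small_support_iff)
  then show ?thesis
  proof induction
    case one
    have "commutator id c = id" using c by (simp add: commutator_def fun_eq_iff)
    then show ?case unfolding gp_simps by (simp only: N.id_closed)
  next
    case (incl s)
    then show ?case by (rule small)
  next
    case (inv s)
    then have "m_inv (gp G) s = iv s" using small_elements_subset by auto
    then show ?case using small[OF small_elements_iv[OF inv]] by simp
  next
    case (eng h1 h2)
    then have "h1 \<in> G" "h2 \<in> G" using generate_subset[OF small_elements_subset] by auto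
    then have "commutator (h2 \<circ> h1) c = conj_by h2 (commutator h1 c) \<circ> commutator h2 c"
      using c by (intro commutator_comp_left) auto
    moreover have "conj_by h2 (commutator h1 c) \<circ> commutator h2 c \<in> N"
      using eng.IH \<open>h2 \<in> G\<close> by (intro N.comp_closed N_conj)
    ultimately show ?case unfolding gp_simps by metis
  qed
qed

text \<open>The passage from small elements to \<open>G\<close> is made in one variable at a time;
  inverting a commutator exchanges the variables.\<close>

lemma derived_subset_N:
  assumes gen: "gen_small_support G"
  shows "derived (gp G) G \<subseteq> N"
proof (rule derived_least)
  fix g h assume G: "g \<in> G" "h \<in> G"
  show "commutator g h \<in> N"
  proof (rule commutator_gen[OF gen G(2) _ G(1)])
    fix s assume s: "s \<in> small_elements G"
    have sG: "s \<in> G" using s small_elements_subset by blast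
    have "commutator h s \<in> N"
      by (rule commutator_gen[OF gen sG _ G(2)])
        (use s commutator_small in \<open>auto simp: small_elements_iff\<close>)
    then show "commutator s h \<in> N"
      using N.iv_closed[of "commutator h s"] sG G by (simp add: iv_commutator)
  qed
qed (rule N.homeo_subgroup_axioms)

end

context vigorous_group
begin

lemma rist_nontrivial:
  assumes "clopen_set A" "A \<noteq> {}"
  obtains g where "g \<in> rist G A" "g \<noteq> id"
proof -
  obtain p where "p \<in> A" using assms by blast
  then obtain g where "g \<in> rist G A" "g p \<notin> insert p {}"
    using rist_moves_off[OF assms(1)] by blast
  moreover from this have "g \<noteq> id" by auto
  ultimately show ?thesis by (intro that)
qed

lemma noncommuting:
  obtains g h where "g \<in> G" "h \<in> G" "commutator g h \<noteq> id"
proof -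
  fix p :: cantor
  obtain g where g: "g \<in> rist G UNIV" "g p \<notin> insert p {}"
    by (rule rist_moves_off[of UNIV p "{}"]) auto
  obtain U where U: "clopen_set U" "g p \<in> U" "U \<inter> {p} = {}"
    using clopen_separates[of "{p}" "g p"] g(2) by auto
  obtain h where h: "h \<in> rist G U" "h (g p) \<notin> insert (g p) {}"
    by (rule rist_moves_off[of U "g p" "{}"]) (use U in auto)
  have G: "g \<in> G" "h \<in> G" using g h by (auto dest: rist_in)
  have "h p = p" using rist_outside[OF h(1)] U(3) by blast
  \<comment> \<open>Going backwards through the commutator, \<open>h (g p)\<close> returns to
    \<open>g p\<close> and then to \<open>p\<close>; \<open>h\<close> fixes \<open>p\<close>, and
    \<open>g\<close> leads back to \<open>g p\<close>.\<close>
  then have "commutator g h (h (g p)) = g p" using G by (simp add: commutator_def)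
  then have "commutator g h \<noteq> id" using h(2) by auto
  with G show ?thesis by (rule that)
qed

section \<open>The full group as a vigorous group\<close>

lemma vigorous_full_group: "vigorous_group (full_group G)"
proof (rule vigorous_group.intro[OF full_group_subgroup], unfold_locales)
  show "vigorous (full_group G)"
    using vigorous subset_full_group unfolding vigorous_def by (meson subsetD)
qed

text \<open>If \<open>f\<close> displaces \<open>U\<close>, let the involution \<open>s\<close>
  exchange \<open>U\<close> with its image along \<open>f\<close> and fix the rest. Both
  \<open>s\<close> and \<open>s \<circ> f\<close> are small, the latter because it fixes
  \<open>U\<close>, and \<open>f = s \<circ> (s \<circ> f)\<close>.\<close>

lemma full_group_gen_small: "gen_small_support (full_group G)"
proof -
  interpret F: homeo_subgroup "full_group G" by (rule full_group_subgroup)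
  interpret S: homeo_subgroup "generate (gp (full_group G)) (small_elements (full_group G))"
    by (rule F.generate_subgroup[OF F.small_elements_subset])
  have "f \<in> generate (gp (full_group G)) (small_elements (full_group G))" if f: "f \<in> full_group G" for f
  proof (cases "f = id")
    case True
    then show ?thesis using S.id_closed by simp
  next
    case False
    then obtain p where "f p \<noteq> p" by (auto simp: fun_eq_iff)
    then obtain U where U: "clopen_set U" "p \<in> U" "U \<inter> f ` U = {}" "U \<union> f ` U \<noteq> UNIV"
      using displaced_clopen[OF F.homeo[OF f]] by metis
    have fU: "clopen_set (f ` U)" using U f by (simp add: clopen_homeo_image)
    define s where "s x = (if x \<in> U then f x else if x \<in> f ` U then iv f x else x)" for x
    have s1: "s x = f x" if "x \<in> U" for x using that by (simp add: s_def)
    have s2: "s x = iv f x" if "x \<in> f ` U" for x using that U(3) by (auto simp: s_def)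
    have s3: "s x = x" if "x \<notin> U \<union> f ` U" for x using that by (auto simp: s_def)
    have sf: "s (f x) = x" if "x \<in> U" for x using that f by (simp add: s2)
    have ss: "s \<circ> s = id"
    proof
      fix x
      consider "x \<in> U" | y where "y \<in> U" "x = f y" | "x \<notin> U \<union> f ` U" by blast
      then show "(s \<circ> s) x = id x"
        by cases (simp_all add: s1 s3 sf)
    qed
    have sF: "s \<in> full_group G"
    proof (rule full_groupI)
      show "bij s" using o_bij[OF ss ss] .
      fix x
      consider "x \<in> U" | "x \<in> f ` U" | "x \<in> - (U \<union> f ` U)" by blast
      then show "\<exists>V g. clopen_set V \<and> x \<in> V \<and> g \<in> G \<and> (\<forall>y\<in>V. s y = g y)"
      proof cases
        case 1
        obtain V g where V: "clopen_set V" "x \<in> V" "g \<in> G" "\<And>y. y \<in> V \<Longrightarrow> f y = g y"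
          using full_groupD[OF f, of x] by metis
        then show ?thesis using 1 U(1) s1
          by (intro exI[of _ "U \<inter> V"] exI[of _ g]) (simp add: clopen_Int)
      next
        case 2
        obtain V g where V: "clopen_set V" "x \<in> V" "g \<in> G" "\<And>y. y \<in> V \<Longrightarrow> iv f y = g y"
          using full_groupD[OF full_group_iv[OF f], of x] by metis
        then show ?thesis using 2 fU s2
          by (intro exI[of _ "f ` U \<inter> V"] exI[of _ g]) (simp add: clopen_Int)
      next
        case 3
        then show ?thesis using U(1) fU s3
          by (intro exI[of _ "- (U \<union> f ` U)"] exI[of _ id]) (simp add: clopen_Int clopen_Compl)
      qed
    qed
    have "s \<in> rist (full_group G) (U \<union> f ` U)"
      using sF s3 unfolding rist_def supp_subset_iff by blast
    moreover have "U \<union> f ` U \<in> K_C"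
      using U fU unfolding K_C_def by (auto intro: clopen_Un)
    ultimately have s: "s \<in> small_elements (full_group G)" by (auto simp: small_elements_iff)
    have "s \<circ> f \<in> rist (full_group G) (- U)"
      using full_group_comp[OF sF f] sf unfolding rist_def supp_subset_iff by simp
    moreover have "- U \<in> K_C" using U unfolding K_C_def by (auto intro: clopen_Compl)
    ultimately have "s \<circ> f \<in> small_elements (full_group G)" by (auto simp: small_elements_iff)
    then have "s \<circ> (s \<circ> f) \<in> generate (gp (full_group G)) (small_elements (full_group G))"
      by (intro S.comp_closed generate.incl s)
    moreover have "s \<circ> (s \<circ> f) = f" unfolding comp_assoc[symmetric] ss by simp
    ultimately show ?thesis by simp
  qed
  then show ?thesis unfolding F.gen_small_support_iff by blast
qed

end

section \<open>Word maps\<close>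

definition letter :: "(nat \<Rightarrow> cantor \<Rightarrow> cantor) \<Rightarrow> nat \<times> bool \<Rightarrow> cantor \<Rightarrow> cantor" where
  "letter h a = (if snd a then iv (h (fst a)) else h (fst a))"

context homeo_subgroup
begin

lemma eval_word_Nil: "eval_word (gp G) [] h = id"
  by (simp add: eval_word_def)

lemma eval_word_Cons:
  assumes "\<And>i. h i \<in> G"
  shows "eval_word (gp G) (a # w) h = eval_word (gp G) w h \<circ> letter h a"
  using assms by (cases a) (simp add: eval_word_def letter_def)

lemma eval_word_in:
  assumes H: "homeo_subgroup H" "H \<subseteq> G" "\<And>i. h i \<in> H"
  shows "eval_word (gp G) w h \<in> H"
proof -
  interpret H: homeo_subgroup H by fact
  have hG: "\<And>i. h i \<in> G" using H by blast
  show ?thesis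
  proof (induction w)
    case Nil
    show ?case unfolding eval_word_Nil by (rule H.id_closed)
  next
    case (Cons a w)
    have "letter h a \<in> H" using H(3) H.iv_closed by (simp add: letter_def)
    with Cons show ?case unfolding eval_word_Cons[OF hG] by (rule H.comp_closed)
  qed
qed

text \<open>Products run from left to right, so the first letter acts first and \<open>q j\<close>
  is the position after \<open>j\<close> letters.\<close>

lemma eval_word_path:
  assumes "\<And>i. h i \<in> G" "\<And>j. j < length w \<Longrightarrow> letter h (w ! j) (q j) = q (Suc j)"
  shows "eval_word (gp G) w h (q 0) = q (length w)"
  using assms(2)
proof (induction w arbitrary: q)
  case Nil
  show ?case by (simp add: eval_word_Nil)
next
  case (Cons a w)
  have "eval_word (gp G) w h (q (Suc 0)) = q (Suc (length w))"
    using Cons.IH[of "\<lambda>j. q (Suc j)"] Cons.prems[of "Suc _"] by simp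
  moreover have "letter h a (q 0) = q (Suc 0)" using Cons.prems[of 0] by simp
  ultimately show ?case unfolding eval_word_Cons[OF assms(1)] by simp
qed

lemma eval_word_conj:
  assumes h: "\<And>i. h i \<in> G" and k: "k \<in> G"
  shows "conj_by k (eval_word (gp G) w h) = eval_word (gp G) w (\<lambda>i. conj_by k (h i))"
proof (induction w)
  case Nil
  show ?case using k by (simp only: eval_word_Nil conj_by_id homeo)
next
  case (Cons a w)
  have "conj_by k (letter h a) = letter (\<lambda>i. conj_by k (h i)) a"
    using h k by (simp add: letter_def conj_by_iv)
  moreover have "\<And>i. conj_by k (h i) \<in> G" using h k conj_closed by blast
  ultimately show ?case
    using Cons k eval_word_Cons[OF h] eval_word_Cons[of "\<lambda>i. conj_by k (h i)"]
    by (simp only: conj_by_comp homeo)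
qed

lemma rist_subgroup: "homeo_subgroup (rist G A)"
proof (rule homeo_subgroup.intro, rule subgroup.intro)
  show "rist G A \<subseteq> carrier homeo_group" using rist_homeo by blast
  fix f assume "f \<in> rist G A"
  then show "m_inv homeo_group f \<in> rist G A" using rist_iv homeo_m_inv by simp
qed (simp_all only: homeo_mult homeo_one rist_id rist_comp)

lemma word_set_subset_small: "word_set_circ w G \<subseteq> small_elements G"
proof
  fix f assume "f \<in> word_set_circ w G"
  then obtain A h where A: "A \<in> K_C" and h: "\<And>i. h i \<in> rist G (- A)" and f: "f = eval_word (gp G) w h"
    by (auto simp: word_set_circ_def word_image_def pstab_eq_rist)
  have "f \<in> pstab G A"
    unfolding f pstab_eq_rist using eval_word_in[OF rist_subgroup rist_subset h] .
  then show "f \<in> small_elements G" using A unfolding small_elements_eq_pstab by blast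
qed

text \<open>Evaluation commutes with conjugation, which carries the pointwise stabilizer of a set to
  that of its image under \<open>k\<close>. Hence the verbal subgroup is normal.\<close>

lemma word_set_conj:
  assumes k: "k \<in> G" and f: "f \<in> word_set_circ w G"
  shows "conj_by k f \<in> word_set_circ w G"
proof -
  obtain A h where A: "A \<in> K_C" and h: "\<And>i. h i \<in> rist G (- A)" and f: "f = eval_word (gp G) w h"
    using f by (auto simp: word_set_circ_def word_image_def pstab_eq_rist)
  have bij: "bij k" using k homeo_bij by blast
  have "k ` A \<noteq> UNIV"
    using A bij unfolding K_C_def
    by (metis (mono_tags, lifting) bij_is_inj bij_is_surj inj_image_eq_iff mem_Collect_eq)
  then have kA: "k ` A \<in> K_C" using A k by (auto simp: K_C_def clopen_homeo_image)
  have hG: "\<And>i. h i \<in> G" using h rist_subset by blast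
  have "conj_by k (h i) \<in> rist G (- (k ` A))" for i
    using rist_conj[OF h, of k i] k hG conj_closed bij_image_Compl_eq[OF bij, of A] by simp
  then show ?thesis
    unfolding f eval_word_conj[OF hG k] word_set_circ_def word_image_def pstab_eq_rist
    using kA by blast
qed

lemma eval_comm_word:
  assumes "\<And>i. h i \<in> G"
  shows "eval_word (gp G) comm_word h = commutator (h 2) (h 1)"
  using assms
  by (simp add: comm_word_def eval_word_Cons eval_word_Nil letter_def commutator_def comp_assoc)

end

context vigorous_group
begin

text \<open>Abert's argument that a group separating points satisfies no law: if the last step of
  the path closes a loop at \<open>q k\<close>, the generator occurring last is corrected by an element
  \<open>d\<close> moving \<open>q k\<close> off the path; as the word is reduced this leaves the earlier steps intact.\<close>
lemma reduced_word_path: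
  assumes A: "clopen_set A" "A \<noteq> {}" and w: "freely_reduced w"
  shows "\<exists>h q. (\<forall>i. h i \<in> rist G A) \<and> inj_on q {..length w} \<and> q ` {..length w} \<subseteq> A \<and>
    (\<forall>j<length w. letter h (w ! j) (q j) = q (Suc j))"
  using w
proof (induction w rule: rev_induct)
  case Nil
  obtain p where "p \<in> A" using A by blast
  show ?case
  proof (intro exI[of _ "\<lambda>_. id"] exI[of _ "\<lambda>_. p"] conjI)
    show "\<forall>i::nat. id \<in> rist G A" by (intro allI rist_id)
  qed (use \<open>p \<in> A\<close> in auto)
next
  case (snoc a w)
  have red: "freely_reduced w" "w \<noteq> [] \<Longrightarrow> \<not> (fst (last w) = fst a \<and> snd (last w) \<noteq> snd a)"
    using snoc.prems by (auto simp: freely_reduced_def successively_append_iff)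
  define n where "n = length w"
  obtain h q where h: "\<And>i. h i \<in> rist G A" and inj: "inj_on q {..n}" and qA: "q ` {..n} \<subseteq> A"
      and path: "\<And>j. j < n \<Longrightarrow> letter h (w ! j) (q j) = q (Suc j)"
    using snoc.IH[OF red(1)] unfolding n_def by blast
  have hG: "h i \<in> G" for i using h rist_in by blast
  have letA: "letter h b \<in> rist G A" for b using h rist_iv by (simp add: letter_def)
  have letG: "letter h b \<in> G" for b using letA rist_in by blast
  define y where "y = letter h a (q n)"
  have yA: "y \<in> A" unfolding y_def using rist_maps[OF letA] qA by blast
  have extend: ?case
    if h': "\<And>i. h' i \<in> rist G A" and z: "z \<in> A" "z \<notin> q ` {..n}" "letter h' a (q n) = z"
      and path': "\<And>j. j < n \<Longrightarrow> letter h' (w ! j) (q j) = q (Suc j)" for h' z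
  proof (intro exI conjI)
    show "\<forall>i. h' i \<in> rist G A" using h' by blast
    show "inj_on (q(Suc n := z)) {..length (w @ [a])}"
      using inj z(2) by (auto simp: n_def[symmetric] inj_on_def atMost_Suc)
    show "(q(Suc n := z)) ` {..length (w @ [a])} \<subseteq> A"
      using qA z(1) by (auto simp: n_def[symmetric] atMost_Suc)
    show "\<forall>j<length (w @ [a]). letter h' ((w @ [a]) ! j) ((q(Suc n := z)) j) = (q(Suc n := z)) (Suc j)"
      using path' z(3) by (auto simp: n_def[symmetric] nth_append less_Suc_eq)
  qed
  show ?case
  proof (cases "y \<in> q ` {..n}")
    case False
    show ?thesis by (rule extend[OF h yA False _ path]) (simp_all add: y_def)
  next
    case True
    then obtain k where k: "k \<le> n" "y = q k" by auto
    obtain U where U: "clopen_set U" "y \<in> U" "U \<inter> (q ` {..n} - {y}) = {}"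
      using clopen_separates[of "q ` {..n} - {y}" y] by auto
    \<comment> \<open>The support of \<open>d\<close> lies in \<open>U\<close>, so \<open>y\<close>
      is the only point of the path that \<open>d\<close> moves.\<close>
    obtain d where d: "d \<in> rist G (U \<inter> A)" "d y \<notin> insert y (q ` {..n})"
      by (rule rist_moves_off[of "U \<inter> A" y "q ` {..n}"]) (use U A yA in \<open>auto intro: clopen_Int\<close>)
    have dG: "d \<in> G" using d rist_in by blast
    have dA: "d \<in> rist G A" using d(1) rist_mono[of "U \<inter> A" A G] by blast
    have fixq: "d (q j) = q j" "iv d (q j) = q j" if "j \<le> n" "q j \<noteq> y" for j
    proof -
      have "q j \<notin> U \<inter> A" using that U(3) by blast
      then show "d (q j) = q j" "iv d (q j) = q j"
        using rist_outside[OF d(1)] rist_outside[OF rist_iv[OF d(1)]] by auto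
    qed
    \<comment> \<open>The correction makes the letter \<open>a\<close> act as before and then apply
      \<open>d\<close>; for an inverse letter, the generator must therefore be preceded by the
      inverse of \<open>d\<close>.\<close>
    define h' where "h' = h(fst a := if snd a then h (fst a) \<circ> iv d else d \<circ> h (fst a))"
    have h'A: "h' i \<in> rist G A" for i
      using h dA rist_comp rist_iv by (simp add: h'_def)
    have let_a: "letter h' a = d \<circ> letter h a"
      using hG dG iv_closed by (simp add: letter_def h'_def iv_comp iv_iv)
    have let_inv: "letter h' b = letter h b \<circ> iv d" if "fst b = fst a" "snd b \<noteq> snd a" for b
      using that hG dG iv_closed by (cases "snd a") (simp_all add: letter_def h'_def iv_comp iv_iv)
    have let_other: "letter h' b = letter h b" if "fst b \<noteq> fst a" for b
      using that by (simp add: letter_def h'_def)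
    show ?thesis
    proof (rule extend[OF h'A])
      show "d y \<in> A" using rist_maps[OF dA yA] .
      show "d y \<notin> q ` {..n}" using d(2) by blast
      show "letter h' a (q n) = d y" unfolding let_a by (simp add: y_def)
      fix j assume j: "j < n"
      consider "fst (w ! j) \<noteq> fst a" | "w ! j = a" | "fst (w ! j) = fst a" "snd (w ! j) \<noteq> snd a"
        unfolding prod_eq_iff by blast
      then show "letter h' (w ! j) (q j) = q (Suc j)"
      proof cases
        case 1
        then show ?thesis using path[OF j] let_other by simp
      next
        case 2
        \<comment> \<open>An earlier occurrence of \<open>a\<close> is affected only if it arrives
          at \<open>y\<close>, but then it would start at \<open>q n\<close>, contradicting
          injectivity of the path.\<close>
        have "q (Suc j) \<noteq> y"
        proof
          assume "q (Suc j) = y"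
          then have "letter h a (q j) = letter h a (q n)" using path[OF j] 2 by (simp add: y_def)
          then have "q j = q n" using homeo_eq_iff[OF homeo[OF letG]] by blast
          then show False using inj j by (auto simp: inj_on_def)
        qed
        then show ?thesis using path[OF j] fixq(1)[of "Suc j"] j unfolding 2 let_a by simp
      next
        case 3
        have inverse: "letter h (w ! j) (letter h a x) = x" for x
          using 3 hG by (cases "snd a") (simp_all add: letter_def)
        \<comment> \<open>An inverse of \<open>a\<close> is affected only if it starts at
          \<open>y\<close>. It would then lead to \<open>q n\<close> and so be the last letter of
          \<open>w\<close>, making \<open>w @ [a]\<close> reducible.\<close>
        have "q j \<noteq> y"
        proof
          assume "q j = y"
          then have "q (Suc j) = q n" using inverse path[OF j] by (simp add: y_def)
          then have "Suc j = n" using inj j by (auto simp: inj_on_def)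
          then have "w \<noteq> []" "j = length w - 1" unfolding n_def by auto
          then have "w ! j = last w" "w \<noteq> []" by (simp_all add: last_conv_nth)
          then show False using red(2) 3 by auto
        qed
        then show ?thesis using path[OF j] fixq(2)[of j] j let_inv[OF 3] by simp
      qed
    qed
  qed
qed

lemma word_set_nontrivial:
  assumes "freely_reduced w" "w \<noteq> []"
  obtains f where "f \<in> word_set_circ w G" "f \<noteq> id"
proof -
  obtain A where A: "clopen_set A" "A \<noteq> {}" "A \<subset> UNIV"
    using clopen_proper_part[OF clopen_UNIV UNIV_not_empty, of "{}"] by blast
  obtain h q where h: "\<And>i. h i \<in> rist G A" and inj: "inj_on q {..length w}"
      and path: "\<And>j. j < length w \<Longrightarrow> letter h (w ! j) (q j) = q (Suc j)"
    using reduced_word_path[OF A(1,2) assms(1)] by blast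
  have "- A \<in> K_C" using A by (auto simp: K_C_def intro: clopen_Compl)
  then have mem: "eval_word (gp G) w h \<in> word_set_circ w G"
    unfolding word_set_circ_def word_image_def pstab_eq_rist using h by (auto intro!: bexI[of _ "- A"])
  have "eval_word (gp G) w h (q 0) = q (length w)"
    by (rule eval_word_path[OF _ path]) (use h rist_in in blast)
  moreover have "q 0 \<noteq> q (length w)" using inj_onD[OF inj, of 0 "length w"] assms(2) by auto
  ultimately have "eval_word (gp G) w h \<noteq> id" by auto
  with mem show ?thesis by (rule that)
qed

end

section \<open>The equivalences\<close>

context vigorous_group
begin

lemma simple_imp_generated:
  assumes simple: "simple_grp (gp G)" and S: "S \<subseteq> G" "\<And>k s. k \<in> G \<Longrightarrow> s \<in> S \<Longrightarrow> conj_by k s \<in> S"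
    and nontriv: "f \<in> S" "f \<noteq> id"
  shows "G = generate (gp G) S"
proof -
  interpret gp: group "gp G" by (rule group_gp)
  have "generate (gp G) S \<lhd> gp G"
    unfolding gp.normal_inv_iff
  proof (intro conjI ballI)
    show "subgroup (generate (gp G) S) (gp G)" using S(1) by (intro gp.generate_is_subgroup) simp
    fix x h assume x: "x \<in> carrier (gp G)" and h: "h \<in> generate (gp G) S"
    then have xG: "x \<in> G" by simp
    \<comment> \<open>Conjugation in the left-to-right product is conjugation of functions by the
      inverse.\<close>
    have "conj_by (iv x) h \<in> generate (gp G) S"
      using xG iv_closed S h by (intro generate_conj_closed) auto
    moreover have "x \<otimes>\<^bsub>gp G\<^esub> h \<otimes>\<^bsub>gp G\<^esub> inv\<^bsub>gp G\<^esub> x = conj_by (iv x) h"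
      unfolding gp_m_inv[OF xG] gp_simps using xG by (simp add: conj_by_def iv_iv comp_assoc)
    ultimately show "x \<otimes>\<^bsub>gp G\<^esub> h \<otimes>\<^bsub>gp G\<^esub> inv\<^bsub>gp G\<^esub> x \<in> generate (gp G) S" by simp
  qed
  moreover have "generate (gp G) S \<noteq> {id}" using nontriv generate.incl[of f S "gp G"] by blast
  ultimately show ?thesis using simple unfolding simple_grp_def gp_simps by blast
qed

lemma simple_imp_flawless:
  assumes "simple_grp (gp G)"
  shows "flawless G"
  unfolding flawless_def
proof (intro allI impI; elim conjE)
  fix w :: word assume "w \<noteq> []" "freely_reduced w"
  then obtain f where "f \<in> word_set_circ w G" "f \<noteq> id" by (metis word_set_nontrivial)
  then show "G = word_subgroup_circ w G"
    unfolding word_subgroup_circ_def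
    using word_set_subset_small small_elements_subset word_set_conj
    by (intro simple_imp_generated[OF assms]) blast+
qed

lemma flawless_imp_comm_word: "flawless G \<Longrightarrow> G = word_subgroup_circ comm_word G"
  by (simp add: flawless_def comm_word_def freely_reduced_def)

text \<open>Each value of the commutator word is both a commutator in \<open>G\<close> and an
  element of small support, so the subgroup they generate lies in both generated subgroups.\<close>

lemma comm_word_imp_perfect:
  assumes "G = word_subgroup_circ comm_word G"
  shows "perfect G" "gen_small_support G"
proof -
  have sub: "word_set_circ comm_word G \<subseteq> G"
    using word_set_subset_small small_elements_subset by blast
  have "word_set_circ comm_word G \<subseteq> derived (gp G) G"
  proof
    fix f assume "f \<in> word_set_circ comm_word G"
    then obtain A h where h: "\<forall>i. h i \<in> pstab G A" "f = eval_word (gp G) comm_word h"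
      unfolding word_set_circ_def word_image_def by blast
    then have hG: "h i \<in> G" for i by (simp add: pstab_def)
    show "f \<in> derived (gp G) G"
      unfolding h(2) eval_comm_word[OF hG] using hG hG by (rule commutator_in_derived)
  qed
  then have "G \<subseteq> derived (gp G) G"
    using generate_least[OF sub _ derived_subgroup] assms unfolding word_subgroup_circ_def by blast
  then show "perfect G" unfolding perfect_def using derived_subset by blast
  show "gen_small_support G"
    unfolding gen_small_support_iff
    using generate_least[OF sub _ generate_subgroup[OF small_elements_subset]]
      word_set_subset_small[of comm_word] assms generate.incl[of _ "small_elements G" "gp G"]
    unfolding word_subgroup_circ_def by blast
qed

lemma perfect_imp_simple:
  assumes "perfect G" "gen_small_support G"
  shows "simple_grp (gp G)"
  unfolding simple_grp_def
proof (intro conjI allI impI)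
  interpret gp: group "gp G" by (rule group_gp)
  show "group (gp G)" by (rule group_gp)
  obtain g where "g \<in> rist G UNIV" "g \<noteq> id" by (rule rist_nontrivial[OF clopen_UNIV UNIV_not_empty])
  then show "carrier (gp G) \<noteq> {\<one>\<^bsub>gp G\<^esub>}" using rist_in unfolding gp_simps by blast
  fix N assume "N \<lhd> gp G"
  then have sub: "subgroup N (gp G)"
    and norm: "\<And>x h. x \<in> G \<Longrightarrow> h \<in> N \<Longrightarrow> x \<otimes>\<^bsub>gp G\<^esub> h \<otimes>\<^bsub>gp G\<^esub> inv\<^bsub>gp G\<^esub> x \<in> N"
    unfolding gp.normal_inv_iff by auto
  show "N = {\<one>\<^bsub>gp G\<^esub>} \<or> N = carrier (gp G)"
  proof (cases "N = {id}")
    case True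
    then show ?thesis by simp
  next
    case False
    interpret NS: normalised_subgroup G N
    proof (rule normalised_subgroup.intro[OF vigorous_group_axioms homeo_subgroup.intro
          normalised_subgroup_axioms.intro])
      show "subgroup N homeo_group"
        using group.incl_subgroup[OF group_homeo subgroup] sub by (simp add: gp_def)
      show "N \<subseteq> G" using subgroup.subset[OF sub] by simp
      fix k n assume kn: "k \<in> G" "n \<in> N"
      have "iv k \<otimes>\<^bsub>gp G\<^esub> n \<otimes>\<^bsub>gp G\<^esub> inv\<^bsub>gp G\<^esub> (iv k) = conj_by k n"
        unfolding gp_m_inv[OF iv_closed[OF kn(1)]] gp_simps
        using kn by (simp add: conj_by_def iv_iv comp_assoc)
      then show "conj_by k n \<in> N" using norm[OF iv_closed[OF kn(1)] kn(2)] by simp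
    qed (rule False)
    have "G \<subseteq> N" using NS.derived_subset_N assms unfolding perfect_def by simp
    then show ?thesis using NS.N_subset by simp
  qed
qed

text \<open>The pieces glue to an element \<open>f\<close> of the full group. Giving up its values
  on the nonempty \<open>D \<delta>\<close> leaves a proper clopen set with proper image, to which
  \<open>extend\<close> applies inside the whole space.\<close>

lemma gen_small_imp_approx_full:
  assumes gen: "gen_small_support G"
  shows "approx_full G"
  unfolding approx_full_def
proof (intro allI impI; elim conjE)
  fix \<Gamma> :: "(cantor \<Rightarrow> cantor) set" and D and \<delta>
  assume fin: "finite \<Gamma>" and \<Gamma>: "\<Gamma> \<subseteq> G" and \<delta>: "\<delta> \<in> \<Gamma>"
    and D: "\<forall>\<gamma>\<in>\<Gamma>. clopen_set (D \<gamma>) \<and> D \<gamma> \<noteq> {}"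
    and disj: "\<forall>\<gamma>\<in>\<Gamma>. \<forall>\<gamma>'\<in>\<Gamma>. \<gamma> \<noteq> \<gamma>' \<longrightarrow> D \<gamma> \<inter> D \<gamma>' = {}"
    and cover: "(\<Union>\<gamma>\<in>\<Gamma>. D \<gamma>) = UNIV"
    and idisj: "\<forall>\<gamma>\<in>\<Gamma>. \<forall>\<gamma>'\<in>\<Gamma>. \<gamma> \<noteq> \<gamma>' \<longrightarrow> \<gamma> ` D \<gamma> \<inter> \<gamma>' ` D \<gamma>' = {}"
    and icover: "(\<Union>\<gamma>\<in>\<Gamma>. \<gamma> ` D \<gamma>) = UNIV"
  define sel where "sel x = (SOME \<gamma>. \<gamma> \<in> \<Gamma> \<and> x \<in> D \<gamma>)" for x
  have sel: "sel x \<in> \<Gamma>" "x \<in> D (sel x)" for x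
  proof -
    have "x \<in> (\<Union>\<gamma>\<in>\<Gamma>. D \<gamma>)" unfolding cover by simp
    then have "\<exists>\<gamma>. \<gamma> \<in> \<Gamma> \<and> x \<in> D \<gamma>" by blast
    then show "sel x \<in> \<Gamma>" "x \<in> D (sel x)" unfolding sel_def by (metis (mono_tags, lifting) someI_ex)+
  qed
  have sel_eq: "sel x = \<gamma>" if "\<gamma> \<in> \<Gamma>" "x \<in> D \<gamma>" for x \<gamma>
    using sel[of x] that disj by blast
  define f where "f x = sel x x" for x
  have f_eq: "f x = \<gamma> x" if "\<gamma> \<in> \<Gamma>" "x \<in> D \<gamma>" for x \<gamma>
    using sel_eq[OF that] by (simp add: f_def)
  have "inj f"
  proof (rule injI)
    fix x y assume xy: "f x = f y"
    have "f z \<in> sel z ` D (sel z)" for z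
      using sel(2) by (simp add: f_def)
    from this[of x] this[of y] have "sel x = sel y" using idisj sel(1) xy by (metis disjoint_iff)
    then have "sel x x = sel x y" using xy by (simp add: f_def)
    then show "x = y" using homeo_eq_iff[OF homeo] sel(1) \<Gamma> by blast
  qed
  moreover have "surj f"
  proof (rule surjI)
    fix y
    have "y \<in> (\<Union>\<gamma>\<in>\<Gamma>. \<gamma> ` D \<gamma>)" unfolding icover by simp
    then have "\<exists>x. f x = y" using f_eq by blast
    then show "f (SOME x. f x = y) = y" by (rule someI_ex)
  qed
  ultimately have bij: "bij f" by (rule bijI)
  have fF: "f \<in> full_group G"
  proof (rule full_groupI[OF bij])
    fix p
    show "\<exists>U g. clopen_set U \<and> p \<in> U \<and> g \<in> G \<and> (\<forall>x\<in>U. f x = g x)"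
      using sel[of p] D \<Gamma> f_eq[OF sel(1)[of p]] by (intro exI[of _ "D (sel p)"] exI[of _ "sel p"]) auto
  qed
  have D\<delta>: "clopen_set (D \<delta>)" "D \<delta> \<noteq> {}" using D \<delta> by auto
  have "f ` (- D \<delta>) \<noteq> UNIV" "- D \<delta> \<noteq> UNIV"
    using D\<delta>(2) bij by (auto simp: bij_image_Compl_eq)
  then have "\<exists>c\<in>rist G UNIV. \<forall>x\<in>- D \<delta>. c x = f x"
    using extend[OF gen fF clopen_Compl[OF D\<delta>(1)] clopen_UNIV] by blast
  then obtain c where c: "c \<in> rist G UNIV" "\<forall>x\<in>- D \<delta>. c x = f x" by blast
  have "c p = \<gamma> p" if "\<gamma> \<in> \<Gamma> - {\<delta>}" "p \<in> D \<gamma>" for \<gamma> p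
  proof -
    have "p \<notin> D \<delta>" using that disj \<delta> by blast
    then show ?thesis using c(2) f_eq[of \<gamma> p] that by simp
  qed
  then show "\<exists>k\<in>G. \<forall>\<gamma>\<in>\<Gamma> - {\<delta>}. \<forall>p\<in>D \<gamma>. k p = \<gamma> p" using rist_in[OF c(1)] by blast
qed

text \<open>The exchange of a displaced set \<open>U\<close> with its image under \<open>g\<close>
  need not lie in \<open>G\<close>, but approximate fullness supplies \<open>c\<close> in
  \<open>G\<close> that agrees with \<open>g\<close> on \<open>U\<close> and with the identity off
  \<open>U\<close> and its image. Then \<open>c\<close> and \<open>iv c \<circ> g\<close> are small,
  with product \<open>g\<close>.\<close>

lemma approx_full_imp_gen_small:
  assumes full: "approx_full G"
  shows "gen_small_support G"
proof -
  interpret S: homeo_subgroup "generate (gp G) (small_elements G)"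
    by (rule generate_subgroup[OF small_elements_subset])
  have "g \<in> generate (gp G) (small_elements G)" if g: "g \<in> G" for g
  proof (cases "g = id")
    case True
    then show ?thesis using S.id_closed by simp
  next
    case False
    then obtain p where p: "g p \<noteq> p" by (auto simp: fun_eq_iff)
    then obtain U where U: "clopen_set U" "p \<in> U" "U \<inter> g ` U = {}" "U \<union> g ` U \<noteq> UNIV"
      using displaced_clopen[OF homeo[OF g]] by metis
    have gU: "clopen_set (g ` U)" "g ` U \<noteq> {}" using U g by (auto simp: clopen_homeo_image)
    txt \<open>The twist by \<open>k\<close> keeps \<open>d\<close> different from \<open>g\<close> when \<open>g\<close> is an involution, as approximate
      fullness needs one group element per piece.\<close>
    obtain k where k: "k \<in> rist G U" "k \<circ> iv g \<noteq> g"
    proof (cases "iv g = g")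
      case True
      obtain k where k: "k \<in> rist G U" "k \<noteq> id"
        by (rule rist_nontrivial[OF U(1)]) (use U(2) in auto)
      have "k \<circ> iv g \<noteq> g"
      proof
        assume "k \<circ> iv g = g"
        then have "k \<circ> iv g \<circ> g = g \<circ> g" by simp
        moreover have "k \<circ> iv g \<circ> g = k" using g by (intro ext) simp
        moreover have "g \<circ> g = id"
          using iv_cancel(1)[OF homeo[OF g]] unfolding True by (intro ext) simp
        ultimately show False using k(2) by simp
      qed
      with k(1) show ?thesis by (rule that)
    next
      case False
      then show ?thesis using that[of id] rist_id by simp
    qed
    define d where "d = k \<circ> iv g"
    have dG: "d \<in> G" unfolding d_def using k(1) g rist_in iv_closed comp_closed by blast
    have "k ` U = U"
    proof
      show "k ` U \<subseteq> U" using rist_image[OF k(1) order_refl] .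
      show "U \<subseteq> k ` U"
      proof
        fix x assume "x \<in> U"
        then have "iv k x \<in> U" using rist_maps[OF rist_iv[OF k(1)]] by blast
        moreover have "x = k (iv k x)" using rist_homeo[OF k(1)] by simp
        ultimately show "x \<in> k ` U" by blast
      qed
    qed
    moreover have "iv g ` g ` U = U" using g by (simp add: image_comp comp_def)
    ultimately have dU: "d ` g ` U = U" unfolding d_def image_comp[symmetric] by simp
    have "g ` U \<noteq> U" using U(2,3) by auto
    then have "d \<noteq> id" using dU by auto
    then have neq: "d \<noteq> g" "g \<noteq> id" "d \<noteq> id"
      using k(2) False unfolding d_def by blast+
    define R where "R = - (U \<union> g ` U)"
    have R: "clopen_set R" unfolding R_def using U(1) gU(1) by (intro clopen_Compl clopen_Un)
    have R_ne: "R \<noteq> {}" using U(4) unfolding R_def by blast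
    define D where "D x = (if x = g then U else if x = d then g ` U else R)" for x
    have D: "D g = U" "D d = g ` U" "D id = R" using neq by (auto simp: D_def)
    have "\<exists>c\<in>G. \<forall>\<gamma>\<in>{g, d, id} - {d}. \<forall>p\<in>D \<gamma>. c p = \<gamma> p"
    proof (rule full[unfolded approx_full_def, rule_format])
      have un: "U \<union> g ` U \<union> R = UNIV" "U \<inter> R = {}" "g ` U \<inter> R = {}" unfolding R_def by auto
      show "finite {g, d, id} \<and> {g, d, id} \<subseteq> G \<and> d \<in> {g, d, id} \<and>
        (\<forall>\<gamma>\<in>{g, d, id}. clopen_set (D \<gamma>) \<and> D \<gamma> \<noteq> {}) \<and>
        (\<forall>\<gamma>\<in>{g, d, id}. \<forall>\<gamma>'\<in>{g, d, id}. \<gamma> \<noteq> \<gamma>' \<longrightarrow> D \<gamma> \<inter> D \<gamma>' = {}) \<and>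
        (\<Union>\<gamma>\<in>{g, d, id}. D \<gamma>) = UNIV \<and>
        (\<forall>\<gamma>\<in>{g, d, id}. clopen_set (\<gamma> ` D \<gamma>)) \<and>
        (\<forall>\<gamma>\<in>{g, d, id}. \<forall>\<gamma>'\<in>{g, d, id}. \<gamma> \<noteq> \<gamma>' \<longrightarrow> \<gamma> ` D \<gamma> \<inter> \<gamma>' ` D \<gamma>' = {}) \<and>
        (\<Union>\<gamma>\<in>{g, d, id}. \<gamma> ` D \<gamma>) = UNIV"
        using g dG U gU R R_ne un
        by (simp only: ball_simps UN_insert UN_empty D dU image_id id_apply insert_subset) 
          (simp add: Int_commute Un_ac)
    qed
    then obtain c where cG: "c \<in> G" and agree: "\<forall>\<gamma>\<in>{g, d, id} - {d}. \<forall>p\<in>D \<gamma>. c p = \<gamma> p"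
      by blast
    have "g \<in> {g, d, id} - {d}" "id \<in> {g, d, id} - {d}" using neq by auto
    then have c: "c \<in> G" "\<And>x. x \<in> U \<Longrightarrow> c x = g x" "\<And>x. x \<in> R \<Longrightarrow> c x = x"
      using cG bspec[OF agree, of g] bspec[OF agree, of id] D by simp_all
    have "c \<in> rist G (U \<union> g ` U)" using c(1,3) unfolding rist_def supp_subset_iff R_def by simp
    moreover have "U \<union> g ` U \<in> K_C" using U gU unfolding K_C_def by (auto intro: clopen_Un)
    ultimately have c1: "c \<in> small_elements G" by (auto simp: small_elements_iff)
    have "iv c (g x) = x" if "x \<in> U" for x using c(1) c(2)[OF that] by (intro iv_eqI) auto
    then have "iv c \<circ> g \<in> rist G (- U)"
      using c(1) g iv_closed comp_closed unfolding rist_def supp_subset_iff by simp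
    moreover have "- U \<in> K_C" using U unfolding K_C_def by (auto intro: clopen_Compl)
    ultimately have "iv c \<circ> g \<in> small_elements G" by (auto simp: small_elements_iff)
    then have "c \<circ> (iv c \<circ> g) \<in> generate (gp G) (small_elements G)"
      by (intro S.comp_closed generate.incl c1)
    moreover have "c \<circ> (iv c \<circ> g) = g" using c(1) by (simp add: fun_eq_iff)
    ultimately show ?thesis by simp
  qed
  then show ?thesis unfolding gen_small_support_iff by blast
qed

text \<open>Conjugating an element supported in \<open>A\<close> uses only the values of
  \<open>f\<close> on \<open>A\<close>, and on a proper clopen set these are taken by some
  \<open>c\<close> in \<open>G\<close>. Small generators thus go to small elements of
  \<open>G\<close>.\<close>

lemma full_group_normalises:
  assumes gen: "gen_small_support G" and f: "f \<in> full_group G" and g: "g \<in> G"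
  shows "conj_by f g \<in> G"
proof -
  have bij: "bij f" using f homeo_bij by simp
  have "conj_by f s \<in> small_elements G" if s: "s \<in> small_elements G" for s
  proof -
    obtain A where A: "A \<in> K_C" "s \<in> rist G A" using s by (auto simp: small_elements_iff)
    have "- A \<noteq> {}" using A(1) by (auto simp: K_C_def)
    then have "f ` (- A) \<noteq> {}" by blast
    then have "f ` A \<noteq> UNIV" using bij by (auto simp: bij_image_Compl_eq)
    then have "\<exists>c\<in>rist G UNIV. \<forall>x\<in>A. c x = f x"
      using A(1) by (intro extend[OF gen f]) (auto simp: K_C_def)
    then obtain c where c: "c \<in> G" "\<And>x. x \<in> A \<Longrightarrow> c x = f x" using rist_in by blast
    \<comment> \<open>On the common image of \<open>A\<close> the inverses of \<open>f\<close> and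
      \<open>c\<close> coincide; elsewhere both inverses land outside \<open>A\<close>, where
      \<open>s\<close> is trivial.\<close>
    have "conj_by f s x = conj_by c s x" for x
    proof (cases "iv f x \<in> A")
      case True
      then have "c (iv f x) = x" using c(2) f by simp
      then have "iv c x = iv f x" using c(1) by (intro iv_eqI) auto
      then show ?thesis using c(2)[OF rist_maps[OF A(2) True]] by (simp add: conj_by_def)
    next
      case False
      have "iv c x \<notin> A"
      proof
        assume "iv c x \<in> A"
        then have "f (iv c x) = x" using c by (metis homeo iv_cancel(2))
        then have "iv f x = iv c x" using f by (intro iv_eqI) auto
        with False \<open>iv c x \<in> A\<close> show False by simp
      qed
      then show ?thesis using False rist_outside[OF A(2)] c(1) f by (simp add: conj_by_def)
    qed
    then have "conj_by f s = conj_by c s" by blast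
    then show ?thesis using small_elements_conj[OF homeo[OF c(1)] conj_closed[OF c(1)] s] by simp
  qed
  then have "conj_by f g \<in> generate (gp G) (small_elements G)"
    using g gen f by (intro generate_conj_closed[OF small_elements_subset]) (auto simp: gen_small_support_iff)
  then show ?thesis using generate_subset[OF small_elements_subset] by blast
qed

lemma perfect_imp_derived_full:
  assumes "perfect G" "gen_small_support G"
  shows "G = derived (gp (full_group G)) (full_group G)"
proof
  interpret F: vigorous_group "full_group G" by (rule vigorous_full_group)
  obtain g where g: "g \<in> rist G UNIV" "g \<noteq> id" by (rule rist_nontrivial[OF clopen_UNIV UNIV_not_empty])
  interpret NS: normalised_subgroup "full_group G" G
    by unfold_locales
      (use subset_full_group full_group_normalises[OF assms(2)] g rist_in[OF g(1)] in auto)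
  show "derived (gp (full_group G)) (full_group G) \<subseteq> G"
    by (rule NS.derived_subset_N[OF full_group_gen_small])
  have "derived (gp G) G \<subseteq> derived (gp (full_group G)) (full_group G)"
    using F.commutator_in_derived subset_full_group F.derived_subgroup
    by (intro derived_least) blast+
  then show "G \<subseteq> derived (gp (full_group G)) (full_group G)"
    using assms(1) unfolding perfect_def by simp
qed

text \<open>As the derived subgroup of the full group, \<open>G\<close> is contained in every
  nontrivial subgroup of \<open>G\<close> normalised by the full group. The derived subgroup of
  \<open>G\<close> and the subgroup generated by its small elements are two such subgroups.\<close>

lemma derived_full_imp_perfect:
  assumes G: "G = derived (gp (full_group G)) (full_group G)"
  shows "perfect G" "gen_small_support G"
proof -
  interpret F: vigorous_group "full_group G" by (rule vigorous_full_group)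
  have norm: "conj_by k g \<in> G" if "k \<in> full_group G" "g \<in> G" for k g
    using F.derived_conj_closed[OF full_group_homeo[OF that(1)] F.conj_closed[OF that(1)]] that(2) G
    by blast
  have contains: "G \<subseteq> N"
    if N: "homeo_subgroup N" "N \<subseteq> G" "\<And>k n. k \<in> full_group G \<Longrightarrow> n \<in> N \<Longrightarrow> conj_by k n \<in> N" "N \<noteq> {id}" for N
  proof -
    interpret N: homeo_subgroup N by (rule N(1))
    interpret NS: normalised_subgroup "full_group G" N
      by unfold_locales (use N subset_full_group in auto)
    show ?thesis using NS.derived_subset_N[OF full_group_gen_small] G by simp
  qed
  have "G \<subseteq> derived (gp G) G"
  proof (rule contains[OF derived_subgroup derived_subset])
    fix k n assume "k \<in> full_group G" "n \<in> derived (gp G) G"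
    then show "conj_by k n \<in> derived (gp G) G" using norm by (intro derived_conj_closed) auto
  next
    obtain g h where gh: "g \<in> G" "h \<in> G" "commutator g h \<noteq> id" by (rule noncommuting)
    then show "derived (gp G) G \<noteq> {id}" using commutator_in_derived by blast
  qed
  then show "perfect G" unfolding perfect_def using derived_subset by blast
  show "gen_small_support G"
    unfolding gen_small_support_iff
  proof (rule contains[OF generate_subgroup[OF small_elements_subset] generate_subset[OF small_elements_subset]])
    fix k n assume k: "k \<in> full_group G" and n: "n \<in> generate (gp G) (small_elements G)"
    show "conj_by k n \<in> generate (gp G) (small_elements G)"
      using k n norm small_elements_conj
      by (intro generate_conj_closed[OF small_elements_subset]) auto
  next
    obtain A where A: "clopen_set A" "A \<noteq> {}" "A \<subset> UNIV"
      using clopen_proper_part[OF clopen_UNIV UNIV_not_empty, of "{}"] by blast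
    obtain g where g: "g \<in> rist G A" "g \<noteq> id" by (rule rist_nontrivial[OF A(1,2)])
    then have "g \<in> small_elements G" using A unfolding small_elements_iff K_C_def by blast
    then show "generate (gp G) (small_elements G) \<noteq> {id}"
      using g(2) generate.incl[of g "small_elements G" "gp G"] by blast
  qed
qed

end

theorem theorem1p7:
  fixes G :: "(cantor \<Rightarrow> cantor) set"
  assumes "subgroup G homeo_group"
    and "vigorous G"
  shows "(simple_grp (gp G) \<longleftrightarrow> flawless G)
       \<and> (flawless G \<longleftrightarrow> G = word_subgroup_circ comm_word G)
       \<and> (G = word_subgroup_circ comm_word G \<longleftrightarrow> perfect G \<and> gen_small_support G)
       \<and> (perfect G \<and> gen_small_support G \<longleftrightarrow> perfect G \<and> approx_full G)
       \<and> (perfect G \<and> approx_full G \<longleftrightarrow>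
            G = derived (gp (full_group G)) (full_group G))"
proof -
  interpret vigorous_group G
    by (intro vigorous_group.intro homeo_subgroup.intro vigorous_group_axioms.intro assms)
  show ?thesis
    using simple_imp_flawless flawless_imp_comm_word comm_word_imp_perfect perfect_imp_simple
      gen_small_imp_approx_full approx_full_imp_gen_small perfect_imp_derived_full derived_full_imp_perfect
    by blast
qed

end
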